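(* Let $\mathcal E$ and $\Gamma$ be two confocal nested ellipses in the Euclidean plane, with $\mathcal E$ contained inside $\Gamma$. Then $\Gamma$ is a caustic for the outer length billiard dynamics outside $\mathcal E$; that is, the outer length billiard map around (the domain bounded by) $\mathcal E$ sends every point of $\Gamma$ to a point of $\Gamma$.
   Context: Outer length billiard map. Let $\Omega\subset\mathbb R^2$ be a strictly convex bounded planar domain with smooth boundary $\partial\Omega$, oriented counter-clockwise, and let $\gamma$ be the arc-length parametrization of $\partial\Omega$ respecting this orientation. Every point $P\in\mathbb R^2\setminus \mathrm{cl}(\Omega)$ lies on exactly two tangent lines to $\partial\Omega$, with tangency points $\gamma(s_0)$ and $\gamma(s_1)$, labelled so that $P-\gamma(s_0)$ is a positive multiple of $\gamma'(s_0)$ and $\gamma(s_1)-P$ is a positive multiple of $\gamma'(s_1)$ (so $P\gamma(s_0)$ is the negative tangent and $P\gamma(s_1)$ the positive tangent). Consider the circle lying in $\mathbb R^2\setminus\Omega$ that is tangent to $\partial\Omega$ at $\gamma(s_1)$ and tangent to the line $P\gamma(s_0)$. The circle and $\partial\Omega$ have one further common tangent line, other than the lines $P\gamma(s_0)$ and $P\gamma(s_1)$; it touches $\partial\Omega$ at a point $\gamma(s_2)$. The image $P'$ of $P$ is the intersection point of this line with the line $P\gamma(s_1)$. The outer length billiard map is $P\mapsto P'$. Caustic. A simple closed curve $\Gamma\subset\mathbb R^2\setminus\mathrm{cl}(\Omega)$ containing $\Omega$ in its bounded component is a caustic for the outer length billiard around $\Omega$ if the outer length billiard map sends every point of $\Gamma$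 to a point of $\Gamma$. *)

theory Defs
  imports "HOL-Complex_Analysis.Complex_Analysis"
begin

text \<open>The Euclidean plane is modelled by the type \<^typ>\<open>complex\<close>.\<close>

definition strictly_convex :: "complex set \<Rightarrow> bool" where
  "strictly_convex \<Omega> \<longleftrightarrow>
     (\<forall>x\<in>closure \<Omega>. \<forall>y\<in>closure \<Omega>. open_segment x y \<subseteq> interior \<Omega>)"

definition smooth_curve :: "(real \<Rightarrow> complex) \<Rightarrow> bool" where
  "smooth_curve \<gamma> \<longleftrightarrow>
     (\<forall>n. ((\<lambda>g t. vector_derivative g (at t)) ^^ n) \<gamma> differentiable_on UNIV)"

text \<open>
  \<^term>\<open>\<gamma>\<close> is extended periodically to the whole line, with period equal to the length
  \<^term>\<open>L\<close> of the boundary; the winding number fixes the counter-clockwise orientation.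
\<close>

definition arc_length_boundary :: "complex set \<Rightarrow> (real \<Rightarrow> complex) \<Rightarrow> real \<Rightarrow> bool" where
  "arc_length_boundary \<Omega> \<gamma> L \<longleftrightarrow>
     smooth_curve \<gamma> \<and>
     (\<forall>s. norm (vector_derivative \<gamma> (at s)) = 1) \<and>
     range \<gamma> = frontier \<Omega> \<and>
     L > 0 \<and>
     (\<forall>s t. \<gamma> s = \<gamma> t \<longleftrightarrow> (\<exists>k::int. t = s + of_int k * L)) \<and>
     (\<forall>z\<in>\<Omega>. winding_number (\<lambda>t. \<gamma> (L * t)) z = 1)"

definition billiard_domain :: "complex set \<Rightarrow> bool" where
  "billiard_domain \<Omega> \<longleftrightarrow>
     open \<Omega> \<and> connected \<Omega> \<and> \<Omega> \<noteq> {} \<and> bounded \<Omega> \<and> strictly_convex \<Omega> \<and>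
     (\<exists>\<gamma> L. arc_length_boundary \<Omega> \<gamma> L)"

definition tangent_line :: "(real \<Rightarrow> complex) \<Rightarrow> real \<Rightarrow> complex set" where
  "tangent_line \<gamma> s = {\<gamma> s + t *\<^sub>R vector_derivative \<gamma> (at s) | t. True}"

definition line_tangent_circle :: "complex set \<Rightarrow> complex \<Rightarrow> real \<Rightarrow> bool" where
  "line_tangent_circle l c r \<longleftrightarrow> (\<exists>q. l \<inter> sphere c r = {q})"

text \<open>
  In the following relation, \<^term>\<open>tangent_line \<gamma> s1 \<inter> sphere c r = {\<gamma> s1}\<close> says that the
  circle is tangent to the boundary at \<^term>\<open>\<gamma> s1\<close>. That the circle lies outside \<^term>\<open>\<Omega>\<close> is
  required of the closed disc it bounds: a circle which merely surrounds \<^term>\<open>\<Omega>\<close> (such as the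
  boundary of \<^term>\<open>\<Omega>\<close> itself, if \<^term>\<open>\<Omega>\<close> is a round disc) must be excluded.
\<close>

definition outer_length_image :: "complex set \<Rightarrow> complex \<Rightarrow> complex \<Rightarrow> bool" where
  "outer_length_image \<Omega> P P' \<longleftrightarrow>
     (\<exists>\<gamma> L s0 s1 s2 c r.
        arc_length_boundary \<Omega> \<gamma> L \<and>
        (\<exists>t>0. P - \<gamma> s0 = t *\<^sub>R vector_derivative \<gamma> (at s0)) \<and>
        (\<exists>t>0. \<gamma> s1 - P = t *\<^sub>R vector_derivative \<gamma> (at s1)) \<and>
        r > 0 \<and> cball c r \<inter> \<Omega> = {} \<and>
        tangent_line \<gamma> s1 \<inter> sphere c r = {\<gamma> s1} \<and>
        line_tangent_circle (affine hull {P, \<gamma> s0}) c r \<and>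
        line_tangent_circle (tangent_line \<gamma> s2) c r \<and>
        tangent_line \<gamma> s2 \<noteq> affine hull {P, \<gamma> s0} \<and>
        tangent_line \<gamma> s2 \<noteq> affine hull {P, \<gamma> s1} \<and>
        tangent_line \<gamma> s2 \<inter> affine hull {P, \<gamma> s1} = {P'})"

definition outer_length_map :: "complex set \<Rightarrow> complex \<Rightarrow> complex" where
  "outer_length_map \<Omega> P = (THE P'. outer_length_image \<Omega> P P')"

definition outer_length_caustic :: "complex set \<Rightarrow> complex set \<Rightarrow> bool" where
  "outer_length_caustic \<Omega> \<Gamma> \<longleftrightarrow>
     billiard_domain \<Omega> \<and>
     (\<exists>g. simple_path g \<and> pathfinish g = pathstart g \<and> path_image g = \<Gamma>) \<and>
     \<Gamma> \<inter> closure \<Omega> = {} \<and>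
     \<Omega> \<subseteq> inside \<Gamma> \<and>
     (\<forall>P\<in>\<Gamma>. outer_length_map \<Omega> P \<in> \<Gamma>)"

definition ellipse :: "complex \<Rightarrow> complex \<Rightarrow> real \<Rightarrow> complex set" where
  "ellipse F1 F2 a = {z. dist z F1 + dist z F2 = 2 * a}"

end

theory Submission
  imports Defs
begin

text \<open>
  Write the inner ellipse as the affine image of the unit circle, \<open>z \<mapsto> m + u (p Re z + \<i> q Im z)\<close>.
  The circle of the construction, tangent from outside at the image of \<open>z\<close>, has its centre at
  \<open>\<mu>\<close> times the normal vector \<open>nrm z\<close> from the point of tangency. That it is also tangent to the
  tangent line at \<open>w \<noteq> z\<close> factors into one equation \<open>tritangent \<mu> z w = 0\<close>, which is affine in \<open>w\<close>.
  On the other hand, the intersection point of the tangents at \<open>z\<close> and \<open>w\<close> lies on the confocal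
  ellipse with parameter \<open>l\<close> if and only if \<open>tritangent (l / (p q)) z w = 0\<close>. For given \<open>z\<close> and \<open>w\<close> the
  equation has a single positive root \<open>\<mu>\<close>; so if \<open>P\<close> lies on the confocal ellipse, then
  \<open>\<mu> = l / (p q)\<close>, the third common tangent belongs to the second solution \<open>w'\<close> for the same
  \<open>\<mu>\<close> and \<open>z\<close>, and \<open>P'\<close>, the intersection of the tangents at \<open>z\<close> and \<open>w'\<close>, lies on the same
  confocal ellipse.
\<close>

section \<open>Smooth curves\<close>

lemma smooth_curve_C1:
  assumes "smooth_curve \<gamma>"
  shows "\<gamma> differentiable (at s)" "continuous_on UNIV (\<lambda>s. vector_derivative \<gamma> (at s))"
proof -
  have "((\<lambda>g t. vector_derivative g (at t)) ^^ 0) \<gamma> differentiable_on UNIV"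
       "((\<lambda>g t. vector_derivative g (at t)) ^^ 1) \<gamma> differentiable_on UNIV"
    using assms unfolding smooth_curve_def by blast+
  thus "\<gamma> differentiable (at s)" "continuous_on UNIV (\<lambda>s. vector_derivative \<gamma> (at s))"
    by (auto simp: differentiable_on_def intro: differentiable_imp_continuous_on)
qed

lemma valid_path_rescale:
  assumes "smooth_curve \<gamma>"
  shows "valid_path (\<lambda>t. \<gamma> (k * t))"
    "((\<lambda>t. \<gamma> (k * t)) has_vector_derivative k *\<^sub>R vector_derivative \<gamma> (at (k * t))) (at t)"
proof -
  have d: "((\<lambda>t. \<gamma> (k * t)) has_vector_derivative k *\<^sub>R vector_derivative \<gamma> (at (k * t))) (at t)" for t
  proof -
    have "((\<gamma> \<circ> (\<lambda>t. k * t)) has_vector_derivative k *\<^sub>R vector_derivative \<gamma> (at (k * t))) (at t)"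
    proof (rule vector_diff_chain_at)
      show "((\<lambda>t. k * t) has_vector_derivative k) (at t)"
        by (auto intro!: derivative_eq_intros simp: has_real_derivative_iff_has_vector_derivative[symmetric])
      show "(\<gamma> has_vector_derivative vector_derivative \<gamma> (at (k * t))) (at (k * t))"
        using smooth_curve_C1(1)[OF assms] by (simp add: vector_derivative_works)
    qed
    thus ?thesis by (simp add: o_def)
  qed
  show "((\<lambda>t. \<gamma> (k * t)) has_vector_derivative k *\<^sub>R vector_derivative \<gamma> (at (k * t))) (at t)" by (rule d)
  have "(\<lambda>t. \<gamma> (k * t)) C1_differentiable_on {0..1}"
    unfolding C1_differentiable_on_eq
  proof (intro conjI ballI)
    show "(\<lambda>t. \<gamma> (k * t)) differentiable at x" for x
      using d[of x] by (rule differentiableI_vector)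
    have "vector_derivative (\<lambda>t. \<gamma> (k * t)) (at t) = k *\<^sub>R vector_derivative \<gamma> (at (k * t))" for t
      using d by (rule vector_derivative_at)
    moreover have "continuous_on {0..1} (\<lambda>t. k *\<^sub>R vector_derivative \<gamma> (at (k * t)))"
      by (intro continuous_intros continuous_on_compose2[OF smooth_curve_C1(2)[OF assms]]) auto
    ultimately show "continuous_on {0..1} (\<lambda>t. vector_derivative (\<lambda>t. \<gamma> (k * t)) (at t))" by simp
  qed
  thus "valid_path (\<lambda>t. \<gamma> (k * t))"
    by (simp add: valid_path_def C1_differentiable_imp_piecewise)
qed

text \<open>The iterated derivatives need not be computed: a set that contains \<open>f\<close> and
  is closed under differentiation contains all of them, and each of its members is
  differentiable.\<close>

lemma smooth_curve_if_closed:
  assumes closed: "\<And>f. f \<in> A \<Longrightarrow> \<exists>f'\<in>A. \<forall>s. (f has_vector_derivative f' s) (at s)"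
    and "f \<in> A"
  shows "smooth_curve f"
proof -
  define \<D> :: "(real \<Rightarrow> complex) \<Rightarrow> real \<Rightarrow> complex" where "\<D> = (\<lambda>g t. vector_derivative g (at t))"
  have step: "\<D> g \<in> A" if g: "g \<in> A" for g
  proof -
    obtain g' where g': "g' \<in> A" "\<And>s. (g has_vector_derivative g' s) (at s)" using closed[OF g] by blast
    hence "\<D> g = g'" by (auto simp: \<D>_def vector_derivative_at)
    thus ?thesis using g' by simp
  qed
  have "(\<D> ^^ n) f \<in> A" for n by (induction n) (use step \<open>f \<in> A\<close> in auto)
  moreover have "g differentiable_on UNIV" if g: "g \<in> A" for g
  proof -
    obtain g' where g': "\<And>s. (g has_vector_derivative g' s) (at s)" using closed[OF g] by blast
    show ?thesis unfolding differentiable_on_def using g' differentiableI_vector by blast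
  qed
  ultimately show ?thesis unfolding smooth_curve_def \<D>_def by blast
qed

section \<open>Lines tangent to a circle\<close>

text \<open>Links the parametric lines of \<open>tangent_line\<close> with the normal equation, from
  which distances to a centre can be read off. The direction \<open>\<i> * n\<close> is the normal
  turned by a right angle.\<close>

lemma line_eq_range:
  fixes n a :: complex
  assumes "n \<noteq> 0" "k \<noteq> 0"
  shows "{a + t *\<^sub>R (k *\<^sub>R (\<i> * n)) |t. True} = {w. n \<bullet> (w - a) = 0}"
proof (intro set_eqI iffI)
  fix w assume "w \<in> {w. n \<bullet> (w - a) = 0}"
  hence 1: "Re n * Re (w - a) + Im n * Im (w - a) = 0" by (simp add: inner_complex_def)
  define N where "N = (Re n)\<^sup>2 + (Im n)\<^sup>2"
  have N: "N \<noteq> 0" using assms by (simp add: N_def complex_eq_iff)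
  define t where "t = (Re n * Im (w - a) - Im n * Re (w - a)) / N"
  have t: "t * N = Re n * Im (w - a) - Im n * Re (w - a)" using N by (simp add: t_def)
  have "N * Re (w - a) = N * (- t * Im n)" "N * Im (w - a) = N * (t * Re n)"
    using 1 t unfolding N_def by (algebra, algebra)
  hence "Re (w - a) = - t * Im n" "Im (w - a) = t * Re n" using N mult_left_cancel by blast+
  hence "w - a = t *\<^sub>R (\<i> * n)" by (simp add: complex_eq_iff)
  hence "w = a + (t / k) *\<^sub>R (k *\<^sub>R (\<i> * n))" using assms by (simp add: algebra_simps)
  thus "w \<in> {a + t *\<^sub>R (k *\<^sub>R (\<i> * n)) |t. True}" by blast
next
  fix w assume "w \<in> {a + t *\<^sub>R (k *\<^sub>R (\<i> * n)) |t. True}"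
  thus "w \<in> {w. n \<bullet> (w - a) = 0}" by (auto simp: inner_complex_def)
qed

text \<open>Measured from the foot of the perpendicular from \<open>c\<close>, the intersection
  condition is an equation in \<open>t\<^sup>2\<close>. Such an equation has exactly one solution
  only when that solution is 0, that is, when the distance from \<open>c\<close> to the line equals
  the radius.\<close>

lemma line_tangent_circle_iff:
  fixes n a c :: complex
  assumes "n \<noteq> 0" "r > 0"
  shows "line_tangent_circle {w. n \<bullet> (w - a) = 0} c r \<longleftrightarrow> \<bar>n \<bullet> (c - a)\<bar> = r * norm n"
proof -
  define d where "d = n \<bullet> (c - a)"
  define N where "N = (norm n)\<^sup>2"
  have N: "N > 0" "n \<bullet> n = N" using assms by (auto simp: N_def dot_square_norm)
  \<comment> \<open>\<open>f\<close> is the foot of the perpendicular from \<open>c\<close> to the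
    line.\<close>
  define f where "f = c - (d / N) *\<^sub>R n"
  have line: "{w. n \<bullet> (w - a) = 0} = range (\<lambda>t. f + t *\<^sub>R (\<i> * n))"
  proof -
    have "n \<bullet> (w - a) = n \<bullet> (w - f)" for w
      using N by (simp add: f_def d_def inner_diff_right inner_add_right)
    thus ?thesis using line_eq_range[of n 1 f] assms by (auto simp: image_def)
  qed
  have sph: "f + t *\<^sub>R (\<i> * n) \<in> sphere c r \<longleftrightarrow> t\<^sup>2 * N = r\<^sup>2 - d\<^sup>2 / N" for t
  proof -
    have "(dist c (f + t *\<^sub>R (\<i> * n)))\<^sup>2 = (norm ((d / N) *\<^sub>R n - t *\<^sub>R (\<i> * n)))\<^sup>2"
      by (simp add: dist_norm f_def)
    also have "\<dots> = (d / N)\<^sup>2 * N + t\<^sup>2 * N"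
      by (simp add: cmod_power2 N_def) algebra
    finally have "(dist c (f + t *\<^sub>R (\<i> * n)))\<^sup>2 = d\<^sup>2 / N + t\<^sup>2 * N" 
      using N by (simp add: power2_eq_square)
    moreover have "f + t *\<^sub>R (\<i> * n) \<in> sphere c r \<longleftrightarrow> (dist c (f + t *\<^sub>R (\<i> * n)))\<^sup>2 = r\<^sup>2"
      using assms by (auto simp: power2_eq_iff_nonneg)
    ultimately show ?thesis by auto
  qed
  have "line_tangent_circle {w. n \<bullet> (w - a) = 0} c r \<longleftrightarrow> (\<exists>!t. t\<^sup>2 * N = r\<^sup>2 - d\<^sup>2 / N)"
  proof -
    have "line_tangent_circle {w. n \<bullet> (w - a) = 0} c r \<longleftrightarrow> (\<exists>!w. w \<in> {w. n \<bullet> (w - a) = 0} \<inter> sphere c r)"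
    proof -
      have iff: "(\<exists>q. S = {q}) \<longleftrightarrow> (\<exists>!w. w \<in> S)" for S :: "complex set" by auto
      show ?thesis unfolding line_tangent_circle_def by (rule iff)
    qed
    also have "\<dots> \<longleftrightarrow> (\<exists>!t. t\<^sup>2 * N = r\<^sup>2 - d\<^sup>2 / N)"
    proof -
      have "(\<exists>!w. w \<in> range h \<inter> S) \<longleftrightarrow> (\<exists>!t. h t \<in> S)" if "inj h"
        for h :: "real \<Rightarrow> complex" and S
      proof -
        have "range h \<inter> S = h ` {t. h t \<in> S}" by auto
        moreover have "(\<exists>!w. w \<in> h ` T) \<longleftrightarrow> (\<exists>!t. t \<in> T)" for T
          using that unfolding Ex1_def inj_def by blast
        ultimately show ?thesis by simp
      qed
      from this[of "\<lambda>t. f + t *\<^sub>R (\<i> * n)" "sphere c r"] show ?thesis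
        unfolding line sph by (simp add: inj_def assms)
    qed
    finally show ?thesis .
  qed
  also have "\<dots> \<longleftrightarrow> r\<^sup>2 - d\<^sup>2 / N = 0"
  proof
    assume "\<exists>!t. t\<^sup>2 * N = r\<^sup>2 - d\<^sup>2 / N"
    then obtain t where t: "t\<^sup>2 * N = r\<^sup>2 - d\<^sup>2 / N" "\<And>s. s\<^sup>2 * N = r\<^sup>2 - d\<^sup>2 / N \<Longrightarrow> s = t" by blast
    have "-t = t" by (rule t(2)) (use t(1) in simp)
    thus "r\<^sup>2 - d\<^sup>2 / N = 0" using t(1) by simp
  next
    assume *: "r\<^sup>2 - d\<^sup>2 / N = 0"
    show "\<exists>!t. t\<^sup>2 * N = r\<^sup>2 - d\<^sup>2 / N" unfolding *
      by (rule ex1I[of _ 0]) (use N in auto)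
  qed
  also have "\<dots> \<longleftrightarrow> d\<^sup>2 = (r * norm n)\<^sup>2"
    using N by (auto simp: N_def field_simps power_mult_distrib)
  also have "\<dots> \<longleftrightarrow> \<bar>d\<bar> = r * norm n"
  proof -
    have "0 \<le> r * norm n" using assms by simp
    thus ?thesis by (auto simp: power2_eq_iff abs_if)
  qed
  finally show ?thesis unfolding d_def .
qed

text \<open>The radius to the only common point \<open>a\<close> must be normal to the line. The
  factor \<mu> is left signed: its sign says on which side of the line the circle lies, which
  \<open>cball_disjoint_iff\<close> decides.\<close>

lemma circle_tangent_at_iff:
  fixes n a c :: complex
  assumes "n \<noteq> 0" "r > 0"
  shows "{w. n \<bullet> (w - a) = 0} \<inter> sphere c r = {a} \<longleftrightarrow>
         (\<exists>\<mu>. c = a + \<mu> *\<^sub>R n \<and> \<bar>\<mu>\<bar> * norm n = r)" (is "?L \<longleftrightarrow> ?R")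
proof
  assume L: ?L
  define x where "x = c - a"
  define N where "N = (Re n)\<^sup>2 + (Im n)\<^sup>2"
  have N: "N \<noteq> 0" using assms by (simp add: N_def complex_eq_iff)
  have r: "norm x = r" using L by (auto simp: dist_norm x_def)
  \<comment> \<open>\<open>w\<close> is the second intersection of the line and the circle, the
    mirror image of \<open>a\<close> in the foot of the perpendicular from \<open>c\<close>. Since
    \<open>a\<close> is the only common point, \<open>t = 0\<close>, and so \<open>x\<close> is
    parallel to \<open>n\<close>.\<close>
  define t where "t = 2 * (Re n * Im x - Im n * Re x) / N"
  define w where "w = a + t *\<^sub>R (\<i> * n)"
  have t: "t * N = 2 * (Re n * Im x - Im n * Re x)" using N by (simp add: t_def)
  have "(Re x + t * Im n)\<^sup>2 + (Im x - t * Re n)\<^sup>2 = (Re x)\<^sup>2 + (Im x)\<^sup>2"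
    using t unfolding N_def by algebra
  hence "(norm (c - w))\<^sup>2 = (norm x)\<^sup>2"
    by (simp add: cmod_power2 w_def x_def algebra_simps)
  hence "w \<in> {w. n \<bullet> (w - a) = 0} \<inter> sphere c r"
    using r assms by (auto simp: dist_norm w_def inner_complex_def power2_eq_iff_nonneg)
  hence "w = a" using L by blast
  hence "t = 0" using assms by (simp add: w_def)
  hence p: "Re n * Im x = Im n * Re x" using t by simp
  define \<mu> where "\<mu> = (Re n * Re x + Im n * Im x) / N"
  have "\<mu> * N = Re n * Re x + Im n * Im x" using N by (simp add: \<mu>_def)
  hence "N * Re x = N * (\<mu> * Re n)" "N * Im x = N * (\<mu> * Im n)"
    using p unfolding N_def by (algebra, algebra)
  hence "Re x = \<mu> * Re n" "Im x = \<mu> * Im n" using N mult_left_cancel by blast+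
  hence mu: "c - a = \<mu> *\<^sub>R n" by (simp add: complex_eq_iff x_def)
  show ?R using mu r by (intro exI[of _ \<mu>]) (auto simp: algebra_simps x_def)
next
  assume ?R
  then obtain \<mu> where c: "c = a + \<mu> *\<^sub>R n" and mu: "\<bar>\<mu>\<bar> * norm n = r" by blast
  have "\<bar>n \<bullet> (c - a)\<bar> = r * norm n"
    using mu by (simp add: c dot_square_norm abs_mult power2_eq_square)
  hence "line_tangent_circle {w. n \<bullet> (w - a) = 0} c r" using line_tangent_circle_iff[OF assms] by blast
  moreover have "a \<in> {w. n \<bullet> (w - a) = 0} \<inter> sphere c r" using mu by (auto simp: c dist_norm)
  moreover have "S = {a}" if "\<exists>q. S = {q}" "a \<in> S" for S using that by auto
  ultimately show ?L unfolding line_tangent_circle_def by iprover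
qed

lemma unit_inner_less_1:
  fixes z w :: complex
  assumes "norm z = 1" "norm w = 1" "z \<noteq> w"
  shows "z \<bullet> w < 1"
proof -
  have "0 < (norm (w - z))\<^sup>2" using assms by simp
  also have "\<dots> = 2 - 2 * (z \<bullet> w)"
    using assms by (simp add: power2_norm_eq_inner inner_diff_left inner_diff_right inner_commute norm_eq_1)
  finally show ?thesis by simp
qed

section \<open>Affine images of the unit circle\<close>

text \<open>The centre is \<open>m\<close>; the axes point along \<open>u\<close> and
  \<open>\<i> * u\<close>, with semi-axes \<open>p\<close> and \<open>q\<close>. Fixing
  \<open>u\<close> as a unit complex number makes the rotation a multiplication.\<close>

locale ellipse_frame =
  fixes m u :: complex and p q :: real
  assumes norm_u [simp]: "norm u = 1" and p_pos: "p > 0" and q_pos: "q > 0"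
begin

definition lin :: "complex \<Rightarrow> complex" where
  "lin z = u * Complex (p * Re z) (q * Im z)"

definition pt :: "complex \<Rightarrow> complex" where
  "pt z = m + lin z"

text \<open>For \<open>z\<close> on the unit circle this is an outward normal at
  \<open>pt z\<close>, deliberately not normalized: it stays linear in \<open>z\<close>, and
  \<open>\<i> * nrm z\<close> is the velocity \<open>lin (\<i> * z)\<close> of the angular
  parametrization. Dividing by its length gives the counter-clockwise unit tangent
  \<open>vel z\<close>.\<close>

definition nrm :: "complex \<Rightarrow> complex" where
  "nrm z = u * Complex (q * Re z) (p * Im z)"

definition vel :: "complex \<Rightarrow> complex" where
  "vel z = (\<i> * nrm z) /\<^sub>R norm (nrm z)"

definition tang :: "complex \<Rightarrow> complex set" where
  "tang z = {w. nrm z \<bullet> (w - pt z) = 0}"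

lemma inner_rot: "(u * x) \<bullet> (u * y) = x \<bullet> y"
proof -
  have "(Re u)\<^sup>2 + (Im u)\<^sup>2 = 1" using norm_u by (simp add: cmod_def)
  thus ?thesis unfolding inner_complex_def by simp algebra
qed

text \<open>Up to the factor \<open>p * q\<close>, \<open>nrm\<close> is the inverse transpose of
  \<open>lin\<close>. Hence incidence with a tangent line of the ellipse pulls back to incidence
  with a tangent line of the unit circle.\<close>

lemma nrm_inner_lin: "nrm z \<bullet> lin w = p * q * (z \<bullet> w)"
  unfolding nrm_def lin_def inner_rot by (simp add: inner_complex_def algebra_simps)

lemma nrm_inner_nrm: "nrm z \<bullet> nrm w = q\<^sup>2 * Re z * Re w + p\<^sup>2 * Im z * Im w"
  unfolding nrm_def inner_rot by (simp add: inner_complex_def power2_eq_square)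

lemma linear_lin: "linear lin"
  by (rule linearI) (auto simp: lin_def complex_eq_iff algebra_simps)

lemma linear_nrm: "linear nrm"
  by (rule linearI) (auto simp: nrm_def complex_eq_iff algebra_simps)

lemmas lin_simps = linear_add[OF linear_lin] linear_diff[OF linear_lin] linear_cmul[OF linear_lin]

lemma u_nz: "u \<noteq> 0" using norm_u by force

lemma lin_ii: "lin (\<i> * z) = \<i> * nrm z"
  by (simp add: lin_def nrm_def complex_eq_iff algebra_simps)

lemma lin_eq_0_iff: "lin z = 0 \<longleftrightarrow> z = 0"
  using u_nz p_pos q_pos unfolding lin_def mult_eq_0_iff by (auto simp: complex_eq_iff)

lemma nrm_eq_0_iff: "nrm z = 0 \<longleftrightarrow> z = 0"
  using u_nz p_pos q_pos unfolding nrm_def mult_eq_0_iff by (auto simp: complex_eq_iff)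

lemma inj_pt: "inj pt"
proof (rule injI)
  fix x y assume "pt x = pt y"
  hence "lin (x - y) = 0" by (simp add: pt_def lin_simps)
  thus "x = y" by (simp add: lin_eq_0_iff)
qed

lemma pt_eq_iff [simp]: "pt x = pt y \<longleftrightarrow> x = y"
  using inj_pt by (auto dest: injD)

lemma surj_pt: "surj pt"
proof (rule surjI)
  fix w
  define x where "x = (w - m) / u"
  show "pt (Complex (Re ((w - m) / u) / p) (Im ((w - m) / u) / q)) = w"
  proof -
    have "Complex (Re x) (Im x) = x" by simp
    thus ?thesis using p_pos q_pos u_nz by (simp add: pt_def lin_def flip: x_def) (simp add: x_def)
  qed
qed

lemma pt_diff: "pt z - pt w = lin (z - w)"
  by (simp add: pt_def lin_simps)

lemma pt_in_tang_iff: "pt w \<in> tang z \<longleftrightarrow> z \<bullet> w = (norm z)\<^sup>2"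
  using p_pos q_pos
  unfolding tang_def pt_diff nrm_inner_lin mem_Collect_eq by (simp add: inner_diff_right dot_square_norm)

lemma norm_vel: "z \<noteq> 0 \<Longrightarrow> norm (vel z) = 1"
  by (simp add: vel_def norm_mult nrm_eq_0_iff)

lemma tang_eq_range: 
  assumes "z \<noteq> 0"
  shows "{pt z + t *\<^sub>R vel z |t. True} = tang z"
  using line_eq_range[of "nrm z" "inverse (norm (nrm z))" "pt z"] assms
  unfolding tang_def vel_def by (simp add: nrm_eq_0_iff)

text \<open>If \<open>pt z\<close> lies on the tangent at \<open>w\<close>, then
  \<open>w \<bullet> z = 1\<close>, the equality case of the Cauchy-Schwarz inequality for unit
  vectors.\<close>

lemma tang_eq_iff:
  assumes "norm z = 1" "norm w = 1"
  shows "tang z = tang w \<longleftrightarrow> z = w"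
proof
  assume "tang z = tang w"
  moreover have "pt z \<in> tang z" by (simp add: tang_def)
  ultimately have "pt z \<in> tang w" by simp
  hence "w \<bullet> z = 1" using assms by (simp add: pt_in_tang_iff)
  hence "(norm (w - z))\<^sup>2 = 0"
    using assms by (simp add: power2_norm_eq_inner inner_diff_left inner_diff_right inner_commute norm_eq_1)
  thus "z = w" by simp
qed simp

section \<open>The equation for tangents common to the ellipse and a circle touching it\<close>

definition tritangent :: "real \<Rightarrow> complex \<Rightarrow> complex \<Rightarrow> real" where
  "tritangent \<mu> z w = p * q * (w \<bullet> z - 1) + 2 * \<mu> * (nrm z \<bullet> nrm w) + \<mu>\<^sup>2 * (p * q) * (1 + w \<bullet> z)"

text \<open>Squaring the condition that distance equals radius gives a polynomial equation that
  splits off the factor \<open>p * q * (D - 1)\<close>. This factor vanishes only at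
  \<open>w = z\<close>, where the line is the tangent at the point of contact; the cofactor is
  \<open>tritangent\<close>.\<close>

lemma tritangent_iff:
  assumes z: "norm z = 1" and w: "norm w = 1" and "z \<noteq> w" "\<mu> > 0"
  shows "line_tangent_circle (tang w) (pt z + \<mu> *\<^sub>R nrm z) (\<mu> * norm (nrm z)) \<longleftrightarrow> tritangent \<mu> z w = 0"
proof -
  define D where "D = w \<bullet> z"
  define B where "B = nrm z \<bullet> nrm w"
  have nz: "z \<noteq> 0" "w \<noteq> 0" using z w by auto
  have D: "D < 1" using unit_inner_less_1[of w z] assms by (simp add: D_def)
  have "line_tangent_circle (tang w) (pt z + \<mu> *\<^sub>R nrm z) (\<mu> * norm (nrm z)) \<longleftrightarrow>
        \<bar>nrm w \<bullet> (pt z + \<mu> *\<^sub>R nrm z - pt w)\<bar> = \<mu> * norm (nrm z) * norm (nrm w)"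
    unfolding tang_def using assms nz by (intro line_tangent_circle_iff) (auto simp: nrm_eq_0_iff)
  also have "nrm w \<bullet> (pt z + \<mu> *\<^sub>R nrm z - pt w) = p * q * (D - 1) + \<mu> * B"
  proof -
    have *: "pt z + \<mu> *\<^sub>R nrm z - pt w = lin (z - w) + \<mu> *\<^sub>R nrm z" by (simp add: pt_def lin_simps)
    have "w \<bullet> w = 1" using w by (simp add: norm_eq_1)
    thus ?thesis
      unfolding * by (simp add: nrm_inner_lin inner_add_right inner_diff_right D_def B_def inner_commute)
  qed
  also have "\<bar>p * q * (D - 1) + \<mu> * B\<bar> = \<mu> * norm (nrm z) * norm (nrm w) \<longleftrightarrow>
             (p * q * (D - 1) + \<mu> * B)\<^sup>2 = (\<mu> * norm (nrm z) * norm (nrm w))\<^sup>2"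
  proof -
    have "0 \<le> \<mu> * norm (nrm z) * norm (nrm w)" using assms by simp
    thus ?thesis by (auto simp: power2_eq_iff abs_if)
  qed
  also have "(\<mu> * norm (nrm z) * norm (nrm w))\<^sup>2 = \<mu>\<^sup>2 * (B\<^sup>2 + (p * q)\<^sup>2 * (1 - D\<^sup>2))"
  proof -
    have "(Re z)\<^sup>2 + (Im z)\<^sup>2 = 1" "(Re w)\<^sup>2 + (Im w)\<^sup>2 = 1" using z w by (auto simp: cmod_def)
    \<comment> \<open>Lagrange's identity: the product of the squared lengths is the squared inner
      product plus the squared determinant. The determinant of the normals is \<open>p * q\<close>
      times that of \<open>z\<close> and \<open>w\<close>, whose square is
      \<open>1 - D\<^sup>2\<close>.\<close>
    hence "(nrm z \<bullet> nrm z) * (nrm w \<bullet> nrm w) = B\<^sup>2 + (p * q)\<^sup>2 * (1 - D\<^sup>2)"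
      unfolding B_def D_def unfolding nrm_inner_nrm unfolding inner_complex_def by algebra
    thus ?thesis by (simp add: power_mult_distrib power2_norm_eq_inner mult.assoc)
  qed
  also have "(p * q * (D - 1) + \<mu> * B)\<^sup>2 = \<mu>\<^sup>2 * (B\<^sup>2 + (p * q)\<^sup>2 * (1 - D\<^sup>2)) \<longleftrightarrow>
             (p * q * (D - 1)) * tritangent \<mu> z w = 0"
  proof -
    have "(p * q * (D - 1) + \<mu> * B)\<^sup>2 - \<mu>\<^sup>2 * (B\<^sup>2 + (p * q)\<^sup>2 * (1 - D\<^sup>2)) = 
             (p * q * (D - 1)) * tritangent \<mu> z w"
      unfolding tritangent_def D_def[symmetric] B_def[symmetric] by algebra
    thus ?thesis by linarith
  qed
  also have "\<dots> \<longleftrightarrow> tritangent \<mu> z w = 0" using D p_pos q_pos by simp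
  finally show ?thesis .
qed

text \<open>The point \<open>pt v\<close> is where the tangents at \<open>pt z\<close> and
  \<open>pt w\<close> meet, and the left side is the equation of the confocal ellipse with squared
  semi-axes \<open>p\<^sup>2 + l\<close> and \<open>q\<^sup>2 + l\<close>. Clearing denominators and
  multiplying by \<open>1 + D\<close> turns it into \<open>tritangent\<close> up to a nonzero
  factor.\<close>

lemma confocal_iff_tritangent:
  assumes z: "norm z = 1" and w: "norm w = 1" and "z \<bullet> w \<noteq> -1" and l_pos: "l > 0"
    and v: "v = (z + w) /\<^sub>R (1 + z \<bullet> w)"
  shows "p\<^sup>2 * (Re v)\<^sup>2 / (p\<^sup>2 + l) + q\<^sup>2 * (Im v)\<^sup>2 / (q\<^sup>2 + l) = 1 \<longleftrightarrow> tritangent (l / (p * q)) z w = 0"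
proof -
  define D where "D = z \<bullet> w"
  have D: "1 + D \<noteq> 0" using assms by (simp add: D_def)
  define x y where "x = Re v" and "y = Im v"
  have xy: "(1 + D) * x = Re z + Re w" "(1 + D) * y = Im z + Im w"
    using D v by (auto simp: x_def y_def D_def)
  define \<mu> where "\<mu> = l / (p * q)"
  have mu: "\<mu> * (p * q) = l" using p_pos q_pos by (simp add: \<mu>_def)
  have pl: "p\<^sup>2 + l > 0" "q\<^sup>2 + l > 0" using l_pos by (auto intro: add_nonneg_pos)
  have "p\<^sup>2 * x\<^sup>2 / (p\<^sup>2 + l) + q\<^sup>2 * y\<^sup>2 / (q\<^sup>2 + l) = 1 \<longleftrightarrow>
        p\<^sup>2 * x\<^sup>2 * (q\<^sup>2 + l) + q\<^sup>2 * y\<^sup>2 * (p\<^sup>2 + l) - (p\<^sup>2 + l) * (q\<^sup>2 + l) = 0"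
  proof -
    have "s / P + t / Q = 1 \<longleftrightarrow> s * Q + t * P - P * Q = 0" if "P > 0" "Q > 0" for s t P Q :: real
      using that by (auto simp: field_simps)
    thus ?thesis using pl by blast
  qed
  also have "\<dots> \<longleftrightarrow> tritangent \<mu> z w = 0"
  proof -
    have 1: "(Re z)\<^sup>2 + (Im z)\<^sup>2 = 1" "(Re w)\<^sup>2 + (Im w)\<^sup>2 = 1" using z w by (auto simp: cmod_def)
    have 2: "D = Re z * Re w + Im z * Im w" by (simp add: D_def inner_complex_def)
    have T: "tritangent \<mu> z w = p * q * (D - 1) + 2 * \<mu> * (q\<^sup>2 * Re z * Re w + p\<^sup>2 * Im z * Im w) + \<mu>\<^sup>2 * (p * q) * (1 + D)"
      by (simp add: tritangent_def nrm_inner_nrm D_def inner_commute)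
    \<comment> \<open>This is \<open>norm (z + w)\<close> squared, namely
      \<open>2 * (1 + D)\<close>, divided by \<open>1 + D\<close>.\<close>
    have 3: "(1 + D) * (x\<^sup>2 + y\<^sup>2) = 2"
    proof -
      have "(1 + D) * ((1 + D) * (x\<^sup>2 + y\<^sup>2)) = (1 + D) * 2" using 1 2 xy by algebra
      thus ?thesis using D mult_left_cancel by blast
    qed
    have 4: "(1 + D) * x\<^sup>2 = 1 + Re z * Re w - Im z * Im w"
    proof -
      have "(1 + D) * ((1 + D) * x\<^sup>2) = (1 + D) * (1 + Re z * Re w - Im z * Im w)" using 1 2 xy by algebra
      thus ?thesis using D mult_left_cancel by blast
    qed
    have 5: "(1 + D) * y\<^sup>2 = 1 - Re z * Re w + Im z * Im w" using 3 4 by (simp add: distrib_left)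
    have "(1 + D) * (p\<^sup>2 * x\<^sup>2 * (q\<^sup>2 + l) + q\<^sup>2 * y\<^sup>2 * (p\<^sup>2 + l) - (p\<^sup>2 + l) * (q\<^sup>2 + l)) = - (p * q * tritangent \<mu> z w)"
      unfolding T mu[symmetric] using 2 4 5 by algebra
    thus ?thesis using D p_pos q_pos by (metis mult_eq_0_iff neg_equal_0_iff_equal less_irrefl)
  qed
  finally show ?thesis by (simp add: x_def y_def \<mu>_def)
qed

text \<open>For \<mu> > 0 the tangent at \<open>pt z\<close> separates the disc from the region. For
  \<mu> < 0 the disc lies on the inner side, and a short step from \<open>pt z\<close> along the
  inward normal reaches a point of both.\<close>

lemma cball_disjoint_iff:
  assumes z: "norm z = 1" and mu: "\<mu> \<noteq> 0"
  shows "cball (pt z + \<mu> *\<^sub>R nrm z) (\<bar>\<mu>\<bar> * norm (nrm z)) \<inter> pt ` ball 0 1 = {} \<longleftrightarrow> \<mu> > 0"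
proof
  assume "\<mu> > 0"
  show "cball (pt z + \<mu> *\<^sub>R nrm z) (\<bar>\<mu>\<bar> * norm (nrm z)) \<inter> pt ` ball 0 1 = {}"
  proof (rule ccontr)
    assume "cball (pt z + \<mu> *\<^sub>R nrm z) (\<bar>\<mu>\<bar> * norm (nrm z)) \<inter> pt ` ball 0 1 \<noteq> {}"
    then obtain y where y: "norm y < 1" "dist (pt z + \<mu> *\<^sub>R nrm z) (pt y) \<le> \<mu> * norm (nrm z)"
      using \<open>\<mu> > 0\<close> by auto
    define e where "e = pt z + \<mu> *\<^sub>R nrm z - pt y"
    have e: "e = lin (z - y) + \<mu> *\<^sub>R nrm z" by (simp add: e_def pt_def lin_simps)
    \<comment> \<open>Along the normal, a point of the region is farther from the centre of the disc
      than the radius; the Cauchy-Schwarz bound on \<open>e\<close> contradicts this.\<close>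
    have "nrm z \<bullet> e = p * q * (1 - z \<bullet> y) + \<mu> * (norm (nrm z))\<^sup>2"
      using z unfolding e by (simp add: inner_add_right nrm_inner_lin inner_diff_right norm_eq_1 dot_square_norm)
    moreover have "z \<bullet> y < 1" using norm_cauchy_schwarz[of z y] y z by simp
    hence "p * q * (1 - z \<bullet> y) > 0" using p_pos q_pos by simp
    moreover have "nrm z \<bullet> e \<le> norm (nrm z) * norm e" by (rule norm_cauchy_schwarz)
    moreover have "norm e \<le> \<mu> * norm (nrm z)" using y by (simp add: e_def dist_norm)
    hence "norm (nrm z) * norm e \<le> norm (nrm z) * (\<mu> * norm (nrm z))" by (rule mult_left_mono) simp
    ultimately show False by (simp add: power2_eq_square mult_ac)
  qed
next
  assume disj: "cball (pt z + \<mu> *\<^sub>R nrm z) (\<bar>\<mu>\<bar> * norm (nrm z)) \<inter> pt ` ball 0 1 = {}"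
  show "\<mu> > 0"
  proof (rule ccontr)
    assume "\<not> \<mu> > 0"
    hence "\<mu> < 0" using mu by simp
    obtain y' where "pt y' = m + nrm z" using surj_pt by (metis surjD)
    then obtain y where y: "lin y = nrm z" by (simp add: pt_def)
    have "z \<noteq> 0" using z by auto
    hence "nrm z \<bullet> nrm z > 0" by (simp add: nrm_eq_0_iff)
    hence "p * q * (z \<bullet> y) > 0" using nrm_inner_lin[of z y] unfolding y by linarith
    moreover have "p * q > 0" using p_pos q_pos by simp
    ultimately have zy: "z \<bullet> y > 0" by (rule zero_less_mult_pos)
    hence "y \<noteq> 0" by auto
    hence yy: "y \<bullet> y > 0" by simp
    \<comment> \<open>The step length \<open>e\<close>: the bound by \<open>-\<mu>\<close> keeps the
      point in the disc, the other bound keeps its preimage \<open>z - e *\<^sub>R y\<close> in the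
      unit ball. Here \<open>y\<close> is the preimage of the normal under
      \<open>lin\<close>.\<close>
    define e where "e = min (-\<mu>) (z \<bullet> y / (y \<bullet> y))"
    have e: "e > 0" "e \<le> -\<mu>" "e * (y \<bullet> y) \<le> z \<bullet> y"
      using zy yy \<open>\<mu> < 0\<close> by (auto simp: e_def min_def field_simps)
    have "(norm (z - e *\<^sub>R y))\<^sup>2 = 1 - 2 * e * (z \<bullet> y) + e * (e * (y \<bullet> y))"
      using z by (simp add: power2_norm_eq_inner inner_diff_left inner_diff_right inner_commute norm_eq_1)
    also have "\<dots> \<le> 1 - 2 * e * (z \<bullet> y) + e * (z \<bullet> y)" using e by (intro add_left_mono mult_left_mono) auto
    also have "\<dots> < 1" using e zy by simp
    finally have "norm (z - e *\<^sub>R y) < 1" by (simp add: power_less_one_iff abs_square_less_1)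
    hence 1: "pt (z - e *\<^sub>R y) \<in> pt ` ball 0 1" by auto
    have "pt z + \<mu> *\<^sub>R nrm z - pt (z - e *\<^sub>R y) = (\<mu> + e) *\<^sub>R nrm z"
      by (simp add: pt_def lin_simps y algebra_simps)
    hence "dist (pt z + \<mu> *\<^sub>R nrm z) (pt (z - e *\<^sub>R y)) = \<bar>\<mu> + e\<bar> * norm (nrm z)"
      by (simp add: dist_norm)
    also have "\<dots> \<le> \<bar>\<mu>\<bar> * norm (nrm z)" using e by (intro mult_right_mono) auto
    finally show False using 1 disj by auto
  qed
qed

text \<open>At \<open>w = z\<close> the expression is a sum of positive terms and at
  \<open>w = -z\<close> a sum of negative ones. So the two tangent lines neither coincide nor are
  parallel, and they have an intersection point.\<close>

lemma tritangent_nz: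
  assumes z: "norm z = 1" and w: "norm w = 1" and mu: "\<mu> > 0" and T: "tritangent \<mu> z w = 0"
  shows "w \<noteq> z" "-1 < z \<bullet> w" "z \<bullet> w < 1"
proof -
  have nz: "z \<noteq> 0" using z by auto
  hence N: "nrm z \<bullet> nrm z > 0" by (simp add: nrm_eq_0_iff)
  have zz: "z \<bullet> z = 1" using z by (simp add: norm_eq_1)
  have pq: "p * q > 0" using p_pos q_pos by simp
  show "w \<noteq> z"
  proof
    assume "w = z"
    hence "2 * \<mu> * (nrm z \<bullet> nrm z) + \<mu>\<^sup>2 * (p * q) * 2 = 0" using T zz by (simp add: tritangent_def)
    moreover have "2 * \<mu> * (nrm z \<bullet> nrm z) > 0" "\<mu>\<^sup>2 * (p * q) * 2 > 0" using N mu pq by auto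
    ultimately show False by linarith
  qed
  thus "z \<bullet> w < 1" using unit_inner_less_1 z w by blast
  show "-1 < z \<bullet> w"
  proof (rule ccontr)
    assume "\<not> -1 < z \<bullet> w"
    hence "\<not> (-z) \<bullet> w < 1" by simp
    hence "w = -z" using unit_inner_less_1[of "-z" w] z w by auto
    moreover have "nrm (-z) = - nrm z" by (rule linear_neg[OF linear_nrm])
    ultimately have "p * q * (-2) - 2 * \<mu> * (nrm z \<bullet> nrm z) = 0" using T zz by (simp add: tritangent_def)
    moreover have "2 * \<mu> * (nrm z \<bullet> nrm z) > 0" using N mu by auto
    ultimately show False using pq by linarith
  qed
qed

text \<open>As a quadratic in \<mu> the equation has leading coefficient
  \<open>p * q * (1 + D) > 0\<close> and constant term \<open>p * q * (D - 1) < 0\<close>. The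
  product of two distinct roots would be negative, so they cannot both be positive.\<close>

lemma tritangent_radius_unique:
  assumes "norm z = 1" "norm w = 1" and mu: "\<mu> > 0" "\<nu> > 0"
    and T: "tritangent \<mu> z w = 0" "tritangent \<nu> z w = 0"
  shows "\<mu> = \<nu>"
proof (rule ccontr)
  assume ne: "\<mu> \<noteq> \<nu>"
  define D where "D = w \<bullet> z"
  define B where "B = nrm z \<bullet> nrm w"
  define r where "r = p * q"
  have D: "-1 < D" "D < 1" using tritangent_nz[OF assms(1-3) T(1)] by (auto simp: D_def inner_commute)
  have r: "r > 0" using p_pos q_pos by (simp add: r_def)
  have T1: "r * (D - 1) + 2 * \<mu> * B + \<mu>\<^sup>2 * r * (1 + D) = 0"
   and T2: "r * (D - 1) + 2 * \<nu> * B + \<nu>\<^sup>2 * r * (1 + D) = 0"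
    using T by (simp_all add: tritangent_def D_def B_def r_def)
  have "(\<mu> - \<nu>) * (2 * B + (\<mu> + \<nu>) * r * (1 + D)) = 0" using T1 T2 by algebra
  hence "2 * B + (\<mu> + \<nu>) * r * (1 + D) = 0" using ne by simp
  hence "r * (D - 1) = \<mu> * \<nu> * r * (1 + D)" using T1 by algebra
  moreover have "r * (D - 1) < 0" using r D by (simp add: mult_less_0_iff)
  moreover have "\<mu> * \<nu> * r * (1 + D) > 0" using r D mu by simp
  ultimately show False by linarith
qed

text \<open>For fixed \<mu> and \<open>z\<close> the equation describes the line
  \<open>k \<bullet> v = d\<close>. It meets the unit circle in \<open>h\<close>, and since its
  distance from the origin is less than 1 it is a secant, with exactly one further point.\<close>

lemma tritangent_second:
  assumes z: "norm z = 1" and h: "norm h = 1" and mu: "\<mu> > 0" and T: "tritangent \<mu> z h = 0"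
  obtains w where "\<And>v. norm v = 1 \<and> v \<noteq> h \<and> tritangent \<mu> z v = 0 \<longleftrightarrow> v = w"
proof -
  define k where "k = (p * q * (1 + \<mu>\<^sup>2)) *\<^sub>R z + (2 * \<mu>) *\<^sub>R Complex (q\<^sup>2 * Re z) (p\<^sup>2 * Im z)"
  define d where "d = p * q * (1 - \<mu>\<^sup>2)"
  have K: "tritangent \<mu> z v = k \<bullet> v - d" for v
    unfolding tritangent_def k_def d_def nrm_inner_nrm
    by (simp add: inner_complex_def algebra_simps)
  \<comment> \<open>Since \<open>z\<close> is a unit vector, this gives
    \<open>norm k > \<bar>d\<bar>\<close>: the line passes strictly inside the unit circle.\<close>
  have kd: "k \<bullet> z > \<bar>d\<bar>"
  proof -
    have zz: "z \<bullet> z = 1" using z by (simp add: norm_eq_1)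
    have nz: "z \<noteq> 0" using z by auto
    hence N: "nrm z \<bullet> nrm z > 0" by (simp add: nrm_eq_0_iff)
    have pq: "p * q > 0" using p_pos q_pos by simp
    have "Complex (q\<^sup>2 * Re z) (p\<^sup>2 * Im z) \<bullet> z = nrm z \<bullet> nrm z"
      unfolding nrm_inner_nrm by (simp add: inner_complex_def)
    hence "k \<bullet> z = p * q * (1 + \<mu>\<^sup>2) + 2 * \<mu> * (nrm z \<bullet> nrm z)"
      by (simp add: k_def inner_add_left zz)
    moreover have "2 * \<mu> * (nrm z \<bullet> nrm z) > 0" using N mu by simp
    moreover have "\<bar>d\<bar> \<le> p * q * (1 + \<mu>\<^sup>2)"
      using pq unfolding d_def abs_mult[of "p * q"] by (intro mult_mono) (auto simp: abs_le_iff)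
    ultimately show ?thesis by linarith
  qed
  have k: "norm k > \<bar>d\<bar>" using kd norm_cauchy_schwarz[of k z] z by simp
  hence k0: "k \<noteq> 0" by auto
  \<comment> \<open>The reflection of \<open>h\<close> in the axis spanned by \<open>k\<close>,
    which preserves both the unit circle and the line.\<close>
  define w where "w = (2 * d / (k \<bullet> k)) *\<^sub>R k - h"
  have kk: "k \<bullet> k > 0" using k0 by simp
  have kh: "k \<bullet> h = d" using T K[of h] by simp
  have kw: "k \<bullet> w = d" using kk kh by (simp add: w_def inner_diff_right)
  have nw: "norm w = 1"
  proof -
    have "w \<bullet> w = 1"
      using h kk kh by (simp add: w_def inner_diff_right inner_diff_left norm_eq_1 inner_commute[of h k])
    thus ?thesis by (simp add: norm_eq_1)
  qed
  have wh: "w \<noteq> h"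
  proof
    assume "w = h"
    hence "2 *\<^sub>R h = (2 * d / (k \<bullet> k)) *\<^sub>R k" by (simp add: w_def scaleR_2 algebra_simps)
    hence "norm (2 *\<^sub>R h) = \<bar>2 * d / (k \<bullet> k)\<bar> * norm k" by (simp only: norm_scaleR)
    hence "2 = 2 * \<bar>d\<bar> / (k \<bullet> k) * norm k" using h kk by (simp add: abs_mult)
    hence "k \<bullet> k = \<bar>d\<bar> * norm k" using kk by (simp add: field_simps)
    hence "norm k * norm k = \<bar>d\<bar> * norm k" by (simp only: dot_square_norm power2_eq_square)
    thus False using k k0 by simp
  qed
  have uniq: "v = w" if v: "norm v = 1" "v \<noteq> h" "k \<bullet> v = d" for v
  proof -
    \<comment> \<open>On the line through \<open>h\<close>, the circle equation is quadratic in
      \<open>t\<close> with root 0; cancelling that root leaves a linear equation, which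
      \<open>v\<close> and \<open>w\<close> both satisfy.\<close>
    have *: "\<exists>t. t * (k \<bullet> k) = - 2 * (h \<bullet> (\<i> * k)) \<and> v = h + t *\<^sub>R (\<i> * k)" if v: "norm v = 1" "v \<noteq> h" "k \<bullet> v = d" for v
    proof -
      have "v \<in> {v. k \<bullet> (v - h) = 0}" using v kh by (simp add: inner_diff_right)
      then obtain t where t: "v = h + t *\<^sub>R (\<i> * k)" using line_eq_range[of k 1 h] k0 by auto
      have t0: "t \<noteq> 0"
      proof
        assume "t = 0"
        thus False using t v(2) by simp
      qed
      have "v \<bullet> v = h \<bullet> h + t * (2 * (h \<bullet> (\<i> * k)) + t * (k \<bullet> k))"
        unfolding t by (simp add: inner_complex_def algebra_simps)
      hence "t * (2 * (h \<bullet> (\<i> * k)) + t * (k \<bullet> k)) = 0" using v(1) h by (simp add: norm_eq_1)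
      hence "t * (k \<bullet> k) = - 2 * (h \<bullet> (\<i> * k))" using t0 by simp
      thus ?thesis using t by blast
    qed
    obtain t s where "t * (k \<bullet> k) = - 2 * (h \<bullet> (\<i> * k))" "s * (k \<bullet> k) = - 2 * (h \<bullet> (\<i> * k))"
        "v = h + t *\<^sub>R (\<i> * k)" "w = h + s *\<^sub>R (\<i> * k)"
      using *[OF v] *[OF nw wh kw] by blast
    moreover from this have "t = s" using kk by (metis mult_right_cancel less_irrefl)
    ultimately show ?thesis by simp
  qed
  show thesis
  proof (rule that[of w])
    fix v show "norm v = 1 \<and> v \<noteq> h \<and> tritangent \<mu> z v = 0 \<longleftrightarrow> v = w"
      using uniq[of v] nw wh kw by (auto simp: K)
  qed
qed

section \<open>Intersection of two tangents and tangents from an exterior point\<close>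

lemma tang_inter:
  assumes z: "norm z = 1" and w: "norm w = 1" and "-1 < z \<bullet> w" "z \<bullet> w < 1"
  shows "tang z \<inter> tang w = {pt ((z + w) /\<^sub>R (1 + z \<bullet> w))}"
proof -
  define D where "D = z \<bullet> w"
  define x where "x = (z + w) /\<^sub>R (1 + D)"
  have D: "-1 < D" "D < 1" using assms by (auto simp: D_def)
  have zz: "z \<bullet> z = 1" "w \<bullet> w = 1" using z w by (auto simp: norm_eq_1)
  have zx: "z \<bullet> x = 1" "w \<bullet> x = 1"
  proof -
    have "1 + D \<noteq> 0" using D by simp
    moreover have "z \<bullet> (z + w) = 1 + D" "w \<bullet> (z + w) = 1 + D"
      using zz by (auto simp: inner_add_right D_def inner_commute[of w z])
    ultimately show "z \<bullet> x = 1" "w \<bullet> x = 1" by (auto simp: x_def)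
  qed
  have uniq: "y = x" if "z \<bullet> y = 1" "w \<bullet> y = 1" for y
  proof -
    define v where "v = y - x"
    have 1: "Re z * Re v + Im z * Im v = 0" "Re w * Re v + Im w * Im v = 0"
      using that zx by (auto simp: v_def inner_complex_def algebra_simps)
    \<comment> \<open>The determinant of the system \<open>z \<bullet> y = 1\<close>,
      \<open>w \<bullet> y = 1\<close>, to which the two tangents pull back; it is nonzero because
      \<open>D\<close> lies strictly between -1 and 1.\<close>
    define \<Delta> where "\<Delta> = Re z * Im w - Im z * Re w"
    have "\<Delta>\<^sup>2 = 1 - D\<^sup>2"
      using zz unfolding \<Delta>_def D_def inner_complex_def by algebra
    moreover have "D\<^sup>2 < 1" using D by (simp add: abs_square_less_1)
    ultimately have "\<Delta> \<noteq> 0" by auto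
    moreover have "\<Delta> * Re v = 0" "\<Delta> * Im v = 0" using 1 unfolding \<Delta>_def by (algebra, algebra)
    ultimately have "v = 0" by (simp add: complex_eq_iff)
    thus ?thesis by (simp add: v_def)
  qed
  have "y \<in> tang z \<inter> tang w \<longleftrightarrow> y = pt x" for y
  proof -
    obtain y' where y: "y = pt y'" using surj_pt by (metis surjD)
    have "z \<bullet> y' = 1 \<and> w \<bullet> y' = 1 \<longleftrightarrow> y' = x" using zx uniq by blast
    thus ?thesis by (simp add: y pt_in_tang_iff z w)
  qed
  thus ?thesis by (auto simp: x_def D_def)
qed

text \<open>Pulled back to the unit circle, the tangency points are \<open>x\<close> divided by
  \<open>1 + \<i> * \<tau>\<close> and by \<open>1 - \<i> * \<tau>\<close>, where \<tau> is the
  length of the tangent segments from \<open>x\<close>. The equivalences also say which of them is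
  the negative and which the positive tangent.\<close>

lemma tangency_points:
  assumes x: "norm x > 1"
  obtains z0 z1 where
    "\<And>z. norm z = 1 \<and> (\<exists>t>0. pt x - pt z = t *\<^sub>R vel z) \<longleftrightarrow> z = z0"
    "\<And>z. norm z = 1 \<and> (\<exists>t>0. pt z - pt x = t *\<^sub>R vel z) \<longleftrightarrow> z = z1"
    "-1 < z1 \<bullet> z0" "z1 \<bullet> z0 < 1" "x = (z1 + z0) /\<^sub>R (1 + z1 \<bullet> z0)"
proof -
  define \<tau> where "\<tau> = sqrt ((norm x)\<^sup>2 - 1)"
  have "(norm x)\<^sup>2 > 1" using x by simp
  hence tau: "\<tau> > 0" "\<tau>\<^sup>2 = (norm x)\<^sup>2 - 1" by (auto simp: \<tau>_def)
  \<comment> \<open>\<open>vel z\<close> is a positive multiple of \<open>lin (\<i> * z)\<close>, so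
    the sign conditions of the billiard become conditions on the unit circle.\<close>
  have vel: "(\<exists>t>0. lin y = t *\<^sub>R vel z) \<longleftrightarrow> (\<exists>t>0. y = t *\<^sub>R (\<i> * z))" if "norm z = 1" for y z
  proof -
    define N where "N = norm (nrm z)"
    have "z \<noteq> 0" using that by auto
    hence N: "N > 0" by (simp add: N_def nrm_eq_0_iff)
    have 1: "lin y = t *\<^sub>R vel z \<longleftrightarrow> y = (t / N) *\<^sub>R (\<i> * z)" for t
    proof -
      have "t *\<^sub>R vel z = lin ((t / N) *\<^sub>R (\<i> * z))"
        by (simp add: vel_def lin_simps lin_ii N_def divide_inverse)
      hence "lin y = t *\<^sub>R vel z \<longleftrightarrow> pt y = pt ((t / N) *\<^sub>R (\<i> * z))" by (simp add: pt_def)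
      thus ?thesis by simp
    qed
    show ?thesis unfolding 1
    proof
      assume "\<exists>t>0. y = (t / N) *\<^sub>R (\<i> * z)"
      then obtain t where "t > 0" "y = (t / N) *\<^sub>R (\<i> * z)" by blast
      thus "\<exists>t>0. y = t *\<^sub>R (\<i> * z)" using N by (intro exI[of _ "t / N"]) auto
    next
      assume "\<exists>t>0. y = t *\<^sub>R (\<i> * z)"
      then obtain t where "t > 0" "y = t *\<^sub>R (\<i> * z)" by blast
      thus "\<exists>t>0. y = (t / N) *\<^sub>R (\<i> * z)" using N by (intro exI[of _ "t * N"]) auto
    qed
  qed
  \<comment> \<open>The sign \<open>s\<close> treats both tangents at once: the condition reads
    \<open>x = z * Complex 1 (s * t)\<close>, and comparing norms forces
    \<open>t = \<tau>\<close>.\<close>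
  have key: "norm z = 1 \<and> (\<exists>t>0. s *\<^sub>R (x - z) = t *\<^sub>R (\<i> * z)) \<longleftrightarrow> z = x / Complex 1 (s * \<tau>)"
    if s: "s = 1 \<or> s = -1" for s z
  proof
    assume "norm z = 1 \<and> (\<exists>t>0. s *\<^sub>R (x - z) = t *\<^sub>R (\<i> * z))"
    then obtain t where z: "norm z = 1" and t: "t > 0" "s *\<^sub>R (x - z) = t *\<^sub>R (\<i> * z)" by blast
    have "x = z * Complex 1 (s * t)" using t s by (auto simp: complex_eq_iff algebra_simps)
    moreover from this have "(norm x)\<^sup>2 = 1 + t\<^sup>2" using z s by (auto simp: norm_mult cmod_power2)
    hence "t = \<tau>" using tau t by (simp add: power2_eq_iff_nonneg)
    ultimately show "z = x / Complex 1 (s * \<tau>)" by (auto simp: complex_eq_iff[of _ 0])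
  next
    assume z: "z = x / Complex 1 (s * \<tau>)"
    hence xz: "x = z * Complex 1 (s * \<tau>)" by (auto simp: complex_eq_iff[of _ 0])
    have "(norm x)\<^sup>2 = (norm z)\<^sup>2 * (1 + \<tau>\<^sup>2)"
      unfolding xz using s by (auto simp: norm_mult power_mult_distrib cmod_power2)
    hence "(1 + \<tau>\<^sup>2) * ((norm z)\<^sup>2 - 1) = 0" using tau by algebra
    moreover have "1 + \<tau>\<^sup>2 > 0" by (simp add: add_pos_nonneg)
    ultimately have "(norm z)\<^sup>2 = 1" by simp
    hence "norm z = 1" using norm_ge_zero[of z] by (auto simp: power2_eq_1_iff simp del: norm_ge_zero)
    moreover have "s *\<^sub>R (x - z) = \<tau> *\<^sub>R (\<i> * z)"
      using s unfolding xz by (auto simp: complex_eq_iff algebra_simps)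
    ultimately show "norm z = 1 \<and> (\<exists>t>0. s *\<^sub>R (x - z) = t *\<^sub>R (\<i> * z))" using tau by blast
  qed
  define z0 z1 where "z0 = x / Complex 1 \<tau>" and "z1 = x / Complex 1 (- \<tau>)"
  have 0: "norm z = 1 \<and> (\<exists>t>0. pt x - pt z = t *\<^sub>R vel z) \<longleftrightarrow> z = z0" for z
    using key[of 1 z] vel[of z "x - z"] unfolding pt_diff z0_def by auto
  have 1: "norm z = 1 \<and> (\<exists>t>0. pt z - pt x = t *\<^sub>R vel z) \<longleftrightarrow> z = z1" for z
    using key[of "-1" z] vel[of z "z - x"] unfolding pt_diff z1_def by auto
  have n: "norm z0 = 1" "norm z1 = 1" using 0 1 by blast+
  define T where "T = 1 + \<tau>\<^sup>2"
  have T: "T > 1" unfolding T_def using tau(1) by simp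
  have z0: "z0 = x * Complex 1 (-\<tau>) /\<^sub>R T" and z1: "z1 = x * Complex 1 \<tau> /\<^sub>R T"
    by (auto simp: z0_def z1_def T_def complex_eq_iff Re_divide Im_divide power2_eq_square field_simps)
  have xT: "(Re x)\<^sup>2 + (Im x)\<^sup>2 = T" using tau by (simp add: T_def cmod_power2)
  \<comment> \<open>\<open>T\<close> is the squared norm of \<open>x\<close>, so this is the double
    angle formula: each tangency point makes with \<open>x\<close> an angle of cosine
    \<open>1 / norm x\<close>.\<close>
  have D: "z1 \<bullet> z0 = 2 / T - 1"
  proof -
    have "(x * Complex 1 \<tau>) \<bullet> (x * Complex 1 (-\<tau>)) = T * (2 - T)"
      using xT unfolding T_def inner_complex_def by simp algebra
    thus ?thesis using T by (simp add: z0 z1 field_simps)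
  qed
  have "z1 + z0 = (2 / T) *\<^sub>R x" using T by (simp add: z0 z1 complex_eq_iff field_simps)
  hence "x = (z1 + z0) /\<^sub>R (1 + z1 \<bullet> z0)" using T by (simp add: D)
  moreover have "-1 < z1 \<bullet> z0" "z1 \<bullet> z0 < 1" using T unfolding D by (auto simp: field_simps)
  ultimately show thesis using that[OF 0 1] by blast
qed

section \<open>Arc-length parametrizations of an ellipse\<close>

abbreviation region :: "complex set" where
  "region \<equiv> pt ` ball 0 1"

lemma inj_lin: "inj lin"
  by (rule injI) (use pt_eq_iff in \<open>simp add: pt_def\<close>)

lemma pt_image: "pt ` S = (+) m ` (lin ` S)"
  by (simp add: image_image pt_def)

lemma closure_region: "closure region = pt ` cball 0 1"
proof -
  have "closure (lin ` ball 0 1) = lin ` closure (ball 0 1)"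
    by (rule closure_injective_linear_image[symmetric]) (rule linear_lin inj_lin)+
  thus ?thesis by (simp add: pt_image closure_translation)
qed

lemma surj_lin: "surj lin"
proof (rule surjI)
  fix w show "lin (inv pt (m + w)) = w"
    using surj_f_inv_f[OF surj_pt, of "m + w"] by (simp add: pt_def)
qed

lemma open_region: "open region"
  unfolding pt_image
  by (intro open_translation open_surjective_linear_image linear_lin surj_lin) auto

lemma frontier_region: "frontier region = pt ` sphere 0 1"
proof -
  have "frontier region = pt ` cball 0 1 - region" by (simp add: frontier_def closure_region interior_open open_region)
  also have "\<dots> = pt ` (cball 0 1 - ball 0 1)" using inj_pt by (simp add: image_set_diff)
  also have "cball 0 1 - ball 0 1 = sphere 0 (1::real)" by auto
  finally show ?thesis by (simp add: cball_diff_eq_sphere)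
qed

lemma convex_region: "convex region"
  unfolding pt_image by (intro convex_translation convex_linear_image linear_lin) auto

lemma bounded_region: "bounded region"
  unfolding pt_image by (intro bounded_translation bounded_linear_image linear_conv_bounded_linear[THEN iffD1] linear_lin) auto

lemma inside_frontier_region: "inside (pt ` sphere 0 1) = region"
  using inside_frontier_eq_interior[OF bounded_region convex_region] open_region
  by (simp add: frontier_region interior_open)

lemma strictly_convex_region: "strictly_convex region"
  unfolding strictly_convex_def
proof (intro ballI)
  fix x y assume "x \<in> closure region" "y \<in> closure region"
  then obtain a b where ab: "norm a \<le> 1" "norm b \<le> 1" "x = pt a" "y = pt b"
    by (auto simp: closure_region)
  have "open_segment x y = pt ` open_segment a b"
    unfolding ab pt_def open_segment_translation open_segment_linear_image[OF linear_lin inj_lin]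
    by (simp add: image_image)
  also have "\<dots> \<subseteq> region"
  proof (rule image_mono, rule subsetI)
    fix c assume "c \<in> open_segment a b"
    from dist_decreases_open_segment[OF this, of 0] show "c \<in> ball 0 1" using ab by auto
  qed
  finally show "open_segment x y \<subseteq> interior region" by (simp add: interior_open open_region)
qed

text \<open>This imaginary part governs the sign of the winding number about the centre
  \<open>m\<close>. It equals \<open>p * q / norm (nrm z)\<close>.\<close>

lemma pt_arc_velocity:
  assumes "norm z = 1"
  shows "Im (vel z * cnj (pt z - m)) > 0"
proof -
  have z: "z \<noteq> 0" using assms by auto
  have "Im ((\<i> * nrm z) * cnj (lin z)) = nrm z \<bullet> lin z" by (simp add: inner_complex_def)
  also have "\<dots> = p * q" using assms by (simp add: nrm_inner_lin norm_eq_1)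
  finally have "Im ((\<i> * nrm z) * cnj (lin z)) > 0" using p_pos q_pos by simp
  moreover have "vel z * cnj (pt z - m) = ((\<i> * nrm z) * cnj (lin z)) /\<^sub>R norm (nrm z)"
    by (simp add: vel_def pt_def)
  ultimately show ?thesis using z by (simp add: nrm_eq_0_iff)
qed

text \<open>The boundary determines the derivative of any arc-length parametrization up to sign. The
  sign is continuous in \<open>s\<close>, hence constant, and winding number 1 excludes the
  clockwise sign. Thus the choice of \<gamma> in \<open>outer_length_image\<close> does not affect
  the tangent directions.\<close>

lemma arc_length_boundary_velocity:
  assumes "arc_length_boundary region \<gamma> L"
  obtains z where "norm z = 1" "\<gamma> s = pt z" "vector_derivative \<gamma> (at s) = vel z"
proof -
  have sm: "smooth_curve \<gamma>" and unit: "\<And>s. norm (vector_derivative \<gamma> (at s)) = 1"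
    and ran: "range \<gamma> = pt ` sphere 0 1" and L: "L > 0"
    and wn: "\<And>z. z \<in> region \<Longrightarrow> winding_number (\<lambda>t. \<gamma> (L * t)) z = 1"
    using assms unfolding arc_length_boundary_def frontier_region by auto
  obtain g where g: "linear g" "\<And>z. g (lin z) = z"
    using linear_injective_left_inverse[OF linear_lin inj_lin] by (auto simp: fun_eq_iff)
  \<comment> \<open>The lift of \<gamma> to the unit circle; differentiating
    \<open>\<zeta> s \<bullet> \<zeta> s = 1\<close> shows its derivative to be orthogonal to
    it.\<close>
  define \<zeta> where "\<zeta> s = g (\<gamma> s - m)" for s
  have zeta: "norm (\<zeta> s) = 1 \<and> \<gamma> s = pt (\<zeta> s)" for s
  proof -
    have "\<gamma> s \<in> pt ` sphere 0 1" using ran by auto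
    thus ?thesis using g by (auto simp: \<zeta>_def pt_def)
  qed
  define D where "D s = vector_derivative \<gamma> (at s)" for s
  have gd: "(\<gamma> has_vector_derivative D s) (at s)" for s
    using smooth_curve_C1(1)[OF sm] by (simp add: D_def vector_derivative_works)
  have bg: "bounded_linear g" using g(1) by (simp add: linear_conv_bounded_linear)
  have zd: "(\<zeta> has_vector_derivative g (D s)) (at s)" for s
  proof -
    have "((\<lambda>s. \<gamma> s - m) has_vector_derivative D s - 0) (at s)"
      by (intro has_vector_derivative_diff gd has_vector_derivative_const)
    from bounded_linear.has_vector_derivative[OF bg this] show ?thesis by (simp add: \<zeta>_def[abs_def])
  qed
  have perp: "\<zeta> s \<bullet> g (D s) = 0" for s
  proof -
    have "((\<lambda>s. \<zeta> s \<bullet> \<zeta> s) has_real_derivative \<zeta> s \<bullet> g (D s) + g (D s) \<bullet> \<zeta> s) (at s)"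
      unfolding has_real_derivative_iff_has_vector_derivative
      by (rule bounded_bilinear.has_vector_derivative[OF bounded_bilinear_inner zd zd])
    moreover have "(\<lambda>s. \<zeta> s \<bullet> \<zeta> s) = (\<lambda>s. 1)" using zeta by (simp add: norm_eq_1)
    ultimately have "((\<lambda>s. 1::real) has_real_derivative \<zeta> s \<bullet> g (D s) + g (D s) \<bullet> \<zeta> s) (at s)" by simp
    from DERIV_unique[OF this DERIV_const] show ?thesis by (simp add: inner_commute)
  qed
  have lg: "lin (g w) = w" for w
  proof -
    obtain v where "w = lin v" using surj_lin by (metis surjD)
    thus ?thesis using g by simp
  qed
  define \<sigma> where "\<sigma> s = D s \<bullet> vel (\<zeta> s)" for s
  have nz: "\<zeta> s \<noteq> 0" for s using zeta[of s] by auto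
  have Dv: "D s = \<sigma> s *\<^sub>R vel (\<zeta> s) \<and> (\<sigma> s = 1 \<or> \<sigma> s = -1)" for s
  proof -
    have "g (D s) \<in> {w. \<zeta> s \<bullet> (w - 0) = 0}" using perp by simp
    then obtain t where "g (D s) = t *\<^sub>R (\<i> * \<zeta> s)"
      using line_eq_range[of "\<zeta> s" 1 0] nz by auto
    hence "D s = t *\<^sub>R (\<i> * nrm (\<zeta> s))" using lg[of "D s"] by (simp add: lin_simps lin_ii)
    hence *: "D s = (t * norm (nrm (\<zeta> s))) *\<^sub>R vel (\<zeta> s)" using nz by (simp add: vel_def nrm_eq_0_iff)
    define r where "r = t * norm (nrm (\<zeta> s))"
    have D: "D s = r *\<^sub>R vel (\<zeta> s)" using * by (simp add: r_def)
    have v: "norm (vel (\<zeta> s)) = 1" by (rule norm_vel[OF nz])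
    have "\<bar>r\<bar> = 1" using unit[of s] v by (simp add: D_def[symmetric] D)
    moreover have "\<sigma> s = r" using v by (simp add: \<sigma>_def D norm_eq_1)
    ultimately show ?thesis using D by auto
  qed
  have conts: "continuous_on UNIV \<sigma>"
  proof -
    have cz: "continuous_on UNIV \<zeta>"
      using zd by (intro continuous_at_imp_continuous_on ballI has_vector_derivative_continuous) auto
    have "continuous_on UNIV (\<lambda>s. nrm (\<zeta> s))"
      by (rule linear_continuous_on_compose[OF cz linear_nrm])
    hence "continuous_on UNIV (\<lambda>s. vel (\<zeta> s))"
      unfolding vel_def by (intro continuous_intros) (auto simp: nrm_eq_0_iff nz)
    thus ?thesis unfolding \<sigma>_def D_def by (intro continuous_intros smooth_curve_C1(2)[OF sm])
  qed
  have "\<sigma> s = 1" for s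
  proof (rule ccontr)
    assume "\<sigma> s \<noteq> 1"
    have neg: "\<sigma> t = -1" for t
    proof (rule ccontr)
      assume "\<sigma> t \<noteq> -1"
      hence "\<sigma> t = 1" "\<sigma> s = -1" using Dv \<open>\<sigma> s \<noteq> 1\<close> by blast+
      moreover have "is_interval (\<sigma> ` UNIV)"
        using connected_continuous_image[OF conts] by (simp add: is_interval_connected_1)
      ultimately have "0 \<in> \<sigma> ` UNIV"
        using mem_is_interval_1_I[of "\<sigma> ` UNIV" "\<sigma> s" "\<sigma> t" 0] rangeI[of \<sigma>] by (simp del: range_eqI) (metis UNIV_I image_eqI)
      then obtain r where "\<sigma> r = 0" by auto
      thus False using Dv[of r] by auto
    qed
    define c where "c t = \<gamma> (L * t)" for t
    have vp: "valid_path c" unfolding c_def by (rule valid_path_rescale(1)[OF sm])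
    have m: "pt 0 = m" by (simp add: pt_def linear_0[OF linear_lin])
    have mc: "m \<notin> path_image c"
    proof
      assume "m \<in> path_image c"
      then obtain t where "\<gamma> (L * t) = pt 0" using m by (auto simp: path_image_def c_def)
      thus False using zeta[of "L * t"] by auto
    qed
    \<comment> \<open>If the sign were -1, the reversed loop would run counter-clockwise, so its
      winding number about \<open>m\<close> would have nonnegative real part; yet it is -1.\<close>
    have "0 \<le> Re (winding_number (reversepath c) m)"
    proof (rule winding_number_pos_le)
      show "valid_path (reversepath c)" using vp by simp
      show "m \<notin> path_image (reversepath c)" using mc by simp
      fix x :: real
      have "reversepath c = (\<lambda>x. c (1 - x))" by (simp add: reversepath_def fun_eq_iff)
      moreover have "((\<lambda>x. c (1 - x)) has_vector_derivative L *\<^sub>R vel (\<zeta> (L * (1 - x)))) (at x)"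
      proof -
        have "((\<lambda>x. c (1 - x)) has_vector_derivative (-1) *\<^sub>R (L *\<^sub>R D (L * (1 - x)))) (at x)"
          unfolding o_def[of c "\<lambda>x. 1 - x", symmetric]
        proof (rule vector_diff_chain_at)
          show "((\<lambda>x. 1 - x) has_vector_derivative -1) (at x)"
            by (auto intro!: derivative_eq_intros simp: has_real_derivative_iff_has_vector_derivative[symmetric])
          show "(c has_vector_derivative L *\<^sub>R D (L * (1 - x))) (at (1 - x))"
            unfolding D_def c_def by (rule valid_path_rescale(2)[OF sm])
        qed
        moreover have "D (L * (1 - x)) = - vel (\<zeta> (L * (1 - x)))" using Dv[of "L * (1 - x)"] neg by simp
        ultimately show ?thesis by simp
      qed
      ultimately have "vector_derivative (reversepath c) (at x) = L *\<^sub>R vel (\<zeta> (L * (1 - x)))"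
        by (simp add: vector_derivative_at)
      moreover have "reversepath c x = pt (\<zeta> (L * (1 - x)))" using zeta by (simp add: reversepath_def c_def)
      ultimately show "0 \<le> Im (vector_derivative (reversepath c) (at x) * cnj (reversepath c x - m))"
        using pt_arc_velocity[of "\<zeta> (L * (1 - x))"] L zeta by (auto intro!: mult_nonneg_nonneg simp: less_imp_le)
    qed
    moreover have "winding_number (reversepath c) m = - winding_number c m"
      by (rule winding_number_reversepath) (use vp mc valid_path_imp_path in auto)
    moreover have "winding_number c m = 1"
      unfolding c_def by (rule wn) (use imageI[of 0 "ball 0 1" pt] m in simp)
    ultimately show False by simp
  qed
  thus thesis using that[of "\<zeta> s"] zeta[of s] Dv[of s] by (simp add: D_def)
qed

lemma arc_length_boundary_surj:
  assumes "arc_length_boundary region \<gamma> L" "norm z = 1"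
  obtains s where "\<gamma> s = pt z" "vector_derivative \<gamma> (at s) = vel z"
proof -
  have "pt z \<in> range \<gamma>" using assms unfolding arc_length_boundary_def frontier_region by auto
  then obtain s where s: "\<gamma> s = pt z" by auto
  obtain y where "norm y = 1" "\<gamma> s = pt y" "vector_derivative \<gamma> (at s) = vel y"
    by (rule arc_length_boundary_velocity[OF assms(1)])
  thus thesis using s that by simp
qed

end

section \<open>Existence of an arc-length parametrization\<close>

lemma global_antiderivative:
  fixes w :: "real \<Rightarrow> real"
  assumes "continuous_on UNIV w"
  obtains S where "\<And>x. (S has_real_derivative w x) (at x)"
proof -
  have "\<exists>S. \<forall>x::real. - \<infinity> < ereal x \<longrightarrow> ereal x < \<infinity> \<longrightarrow> (S has_vector_derivative w x) (at x)"
    by (rule einterval_antiderivative) (use assms in \<open>auto simp: continuous_on_eq_continuous_at\<close>)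
  thus thesis using that by (auto simp: has_real_derivative_iff_has_vector_derivative)
qed

text \<open>\<open>S\<close> is the arc length as a function of the angle, \<open>\<phi>\<close> its
  inverse and \<open>L\<close> the length of one turn. Since \<open>S\<close> grows by
  \<open>L\<close> over each period of the speed, \<open>\<phi>\<close> carries shifts by
  \<open>L\<close> to shifts by a full angle.\<close>

lemma periodic_speed_reparam:
  fixes w :: "real \<Rightarrow> real"
  assumes cont: "continuous_on UNIV w" and pos: "\<And>x. w x > 0" and per: "\<And>x. w (x + 2 * pi) = w x"
  obtains \<phi> L where "L > 0" "\<And>s. (\<phi> has_real_derivative 1 / w (\<phi> s)) (at s)"
    "surj \<phi>" "\<And>s t (k::int). \<phi> t = \<phi> s + of_int k * (2 * pi) \<longleftrightarrow> t = s + of_int k * L"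
proof -
  obtain S where S: "\<And>x. (S has_real_derivative w x) (at x)"
    using global_antiderivative[OF cont] by blast
  have mono: "S x < S y" if "x < y" for x y
    by (rule DERIV_pos_imp_increasing[OF that]) (use S pos in blast)
  define L where "L = S (2 * pi) - S 0"
  have L: "L > 0" using mono[of 0 "2 * pi"] by (simp add: L_def)
  have plus: "S (x + 2 * pi) = S x + L" for x
  proof -
    have "((\<lambda>x. S (x + 2 * pi) - S x) has_real_derivative 0) (at x)" for x
    proof -
      have "((\<lambda>x. S (x + 2 * pi)) has_real_derivative w (x + 2 * pi)) (at x)"
        using S[of "x + 2 * pi"] by (simp add: DERIV_shift)
      from DERIV_diff[OF this S[of x]] show ?thesis by (simp add: per)
    qed
    hence "S (x + 2 * pi) - S x = S (0 + 2 * pi) - S 0"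
      using DERIV_isconst_all by blast
    thus ?thesis by (simp add: L_def)
  qed
  have plus_int: "S (x + of_int k * (2 * pi)) = S x + of_int k * L" for x k
  proof (induction k arbitrary: x rule: int_induct[of _ 0])
    case (step1 i)
    show ?case using plus[of "x + of_int i * (2 * pi)"] step1 by (simp add: algebra_simps)
  next
    case (step2 i)
    show ?case using plus[of "x + of_int (i - 1) * (2 * pi)"] step2 by (simp add: algebra_simps)
  qed simp
  have contS: "continuous_on X S" for X
    using S by (meson DERIV_isCont continuous_at_imp_continuous_on)
  have surjS: "\<exists>x. S x = y" for y
  proof -
    \<comment> \<open>After \<open>k\<close> turns in either direction \<open>S\<close> has moved by
      at least the distance from \<open>S 0\<close> to \<open>y\<close>, so \<open>y\<close> lies
      between the two values and the intermediate value theorem applies.\<close>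
    obtain k :: int where k: "\<bar>y - S 0\<bar> / L \<le> of_int k" using ex_le_of_int by blast
    hence "\<bar>y - S 0\<bar> \<le> of_int k * L" using L by (simp add: field_simps)
    hence "S 0 + of_int (-k) * L \<le> y" "y \<le> S 0 + of_int k * L" by auto
    moreover have "k \<ge> 0"
    proof -
      have "0 \<le> \<bar>y - S 0\<bar> / L" using L by simp
      thus ?thesis using k by linarith
    qed
    hence "of_int (-k) * (2 * pi) \<le> of_int k * (2 * pi)" by (intro mult_right_mono) auto
    ultimately show ?thesis
      using IVT'[of S "0 + of_int (-k) * (2 * pi)" y "0 + of_int k * (2 * pi)"] contS
      unfolding plus_int by auto
  qed
  have injS: "S x = S y \<longleftrightarrow> x = y" for x y
    using mono[of x y] mono[of y x] by (cases x y rule: linorder_cases) auto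
  define \<phi> where "\<phi> = inv S"
  have Sphi: "S (\<phi> s) = s" for s unfolding \<phi>_def using surjS by (metis f_inv_into_f rangeI)
  have phiS: "\<phi> (S x) = x" for x using Sphi[of "S x"] injS by simp
  show thesis
  proof (rule that[OF L, of \<phi>])
    fix s show "(\<phi> has_real_derivative 1 / w (\<phi> s)) (at s)"
      using has_field_derivative_inverse_strong[OF S[of "\<phi> s"] _ open_UNIV _ contS phiS] pos[of "\<phi> s"]
      by (simp add: Sphi inverse_eq_divide)
  next
    show "surj \<phi>" using phiS by (metis surjI)
  next
    fix s t k
    have "\<phi> t = \<phi> s + of_int k * (2 * pi) \<longleftrightarrow> S (\<phi> t) = S (\<phi> s + of_int k * (2 * pi))" by (simp add: injS)
    thus "\<phi> t = \<phi> s + of_int k * (2 * pi) \<longleftrightarrow> t = s + of_int k * L" by (simp add: plus_int Sphi)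
  qed
qed

context ellipse_frame
begin

text \<open>The speed of the angular parametrization \<open>pt (cis \<theta>)\<close>, whose
  velocity is \<open>\<i> * nrm (cis \<theta>)\<close>.\<close>

definition speed :: "real \<Rightarrow> real" where
  "speed \<theta> = norm (nrm (cis \<theta>))"

lemma speed_pos: "speed \<theta> > 0"
  by (simp add: speed_def nrm_eq_0_iff)

lemma speed_eq: "speed \<theta> = sqrt (q\<^sup>2 * (cos \<theta>)\<^sup>2 + p\<^sup>2 * (sin \<theta>)\<^sup>2)"
  by (simp add: speed_def norm_eq_sqrt_inner nrm_inner_nrm power2_eq_square mult.assoc)

text \<open>The derivative is written as a polynomial in sine, cosine and the reciprocal speed, the
  generators of \<open>arc_algebra\<close>.\<close>

lemma speed_deriv: "((\<lambda>\<theta>. 1 / speed \<theta>) has_real_derivative (q\<^sup>2 - p\<^sup>2) * sin \<theta> * cos \<theta> * (1 / speed \<theta>) ^ 3) (at \<theta>)"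
proof -
  define h where "h \<theta> = q\<^sup>2 * (cos \<theta>)\<^sup>2 + p\<^sup>2 * (sin \<theta>)\<^sup>2" for \<theta>
  have sp: "speed = (\<lambda>\<theta>. sqrt (h \<theta>))" by (simp add: fun_eq_iff speed_eq h_def)
  have h: "h \<theta> > 0" using speed_pos[of \<theta>] by (simp add: sp)
  have h': "(h has_real_derivative 2 * (p\<^sup>2 - q\<^sup>2) * sin \<theta> * cos \<theta>) (at \<theta>)"
    unfolding h_def by (auto intro!: derivative_eq_intros simp: algebra_simps)
  have "((\<lambda>\<theta>. sqrt (h \<theta>)) has_real_derivative
       (p\<^sup>2 - q\<^sup>2) * sin \<theta> * cos \<theta> * (1 / sqrt (h \<theta>))) (at \<theta>)"
    using h h' by (auto intro!: derivative_eq_intros simp: field_simps)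
  hence "((\<lambda>\<theta>. inverse (sqrt (h \<theta>))) has_real_derivative
       (q\<^sup>2 - p\<^sup>2) * sin \<theta> * cos \<theta> * (1 / sqrt (h \<theta>)) ^ 3) (at \<theta>)"
    by (rule DERIV_cong[OF DERIV_inverse_fun]) (use h in \<open>auto simp: field_simps power3_eq_cube\<close>)
  thus ?thesis unfolding sp inverse_eq_divide .
qed

text \<open>
  If \<open>\<phi>\<close> inverts the arc length, so that \<open>\<phi>' = 1 / speed \<phi>\<close>, this algebra is closed under
  differentiation; hence the curve, which belongs to it, is smooth.
\<close>

inductive_set arc_algebra :: "(real \<Rightarrow> real) \<Rightarrow> (real \<Rightarrow> complex) set" for \<phi> where
  const: "(\<lambda>s. c) \<in> arc_algebra \<phi>"
| cos: "(\<lambda>s. of_real (cos (\<phi> s))) \<in> arc_algebra \<phi>"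
| sin: "(\<lambda>s. of_real (sin (\<phi> s))) \<in> arc_algebra \<phi>"
| inverse_speed: "(\<lambda>s. of_real (1 / speed (\<phi> s))) \<in> arc_algebra \<phi>"
| add: "f \<in> arc_algebra \<phi> \<Longrightarrow> g \<in> arc_algebra \<phi> \<Longrightarrow> (\<lambda>s. f s + g s) \<in> arc_algebra \<phi>"
| mult: "f \<in> arc_algebra \<phi> \<Longrightarrow> g \<in> arc_algebra \<phi> \<Longrightarrow> (\<lambda>s. f s * g s) \<in> arc_algebra \<phi>"

lemma arc_algebra_closed:
  assumes phi: "\<And>s. (\<phi> has_real_derivative 1 / speed (\<phi> s)) (at s)"
    and f: "f \<in> arc_algebra \<phi>"
  shows "\<exists>f'\<in>arc_algebra \<phi>. \<forall>s. (f has_vector_derivative f' s) (at s)"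
  using f
proof induction
  case (const c)
  have "\<forall>s. ((\<lambda>s. c) has_vector_derivative 0) (at s)" by (auto intro: derivative_intros)
  thus ?case by (intro bexI[OF _ arc_algebra.const])
next
  case cos
  let ?f' = "\<lambda>s. (-1) * (of_real (sin (\<phi> s)) * of_real (1 / speed (\<phi> s))) :: complex"
  have d: "((\<lambda>s. of_real (cos (\<phi> s))) has_vector_derivative ?f' s) (at s)" for s
  proof -
    have "((\<lambda>s. cos (\<phi> s)) has_real_derivative - sin (\<phi> s) * (1 / speed (\<phi> s))) (at s)"
      by (rule DERIV_fun_cos[OF phi])
    from has_vector_derivative_of_real[where 'a = complex, OF this]
    show ?thesis by simp
  qed
  have mem: "?f' \<in> arc_algebra \<phi>" by (intro arc_algebra.intros)
  show ?case by (rule bexI[OF _ mem]) (rule allI, rule d)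
next
  case sin
  let ?f' = "\<lambda>s. of_real (cos (\<phi> s)) * of_real (1 / speed (\<phi> s)) :: complex"
  have d: "((\<lambda>s. of_real (sin (\<phi> s))) has_vector_derivative ?f' s) (at s)" for s
  proof -
    have "((\<lambda>s. sin (\<phi> s)) has_real_derivative cos (\<phi> s) * (1 / speed (\<phi> s))) (at s)"
      by (rule DERIV_fun_sin[OF phi])
    from has_vector_derivative_of_real[where 'a = complex, OF this]
    show ?thesis by simp
  qed
  have mem: "?f' \<in> arc_algebra \<phi>" by (intro arc_algebra.intros)
  show ?case by (rule bexI[OF _ mem]) (rule allI, rule d)
next
  case inverse_speed
  let ?\<rho> = "\<lambda>s. of_real (1 / speed (\<phi> s)) :: complex"
  \<comment> \<open>Three factors of the reciprocal speed come from \<open>speed_deriv\<close>; the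
    fourth is the derivative of \<open>\<phi>\<close> in the chain rule.\<close>
  let ?f' = "\<lambda>s. of_real (q\<^sup>2 - p\<^sup>2) * of_real (sin (\<phi> s)) * of_real (cos (\<phi> s)) * (?\<rho> s * ?\<rho> s * ?\<rho> s * ?\<rho> s)"
  have d: "(?\<rho> has_vector_derivative ?f' s) (at s)" for s
  proof -
    have "((\<lambda>s. 1 / speed (\<phi> s)) has_real_derivative
        (q\<^sup>2 - p\<^sup>2) * sin (\<phi> s) * cos (\<phi> s) * (1 / speed (\<phi> s)) ^ 3 * (1 / speed (\<phi> s))) (at s)"
      by (rule DERIV_chain2[OF speed_deriv phi])
    from has_vector_derivative_of_real[where 'a = complex, OF this]
    show ?thesis by (simp add: power3_eq_cube mult.assoc)
  qed
  have mem: "?f' \<in> arc_algebra \<phi>" by (intro arc_algebra.intros)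
  show ?case by (rule bexI[OF _ mem]) (rule allI, rule d)
next
  case (add f g)
  then obtain f' g' where "f' \<in> arc_algebra \<phi>" "g' \<in> arc_algebra \<phi>"
    "\<And>s. (f has_vector_derivative f' s) (at s)" "\<And>s. (g has_vector_derivative g' s) (at s)" by blast
  thus ?case by (intro bexI[of _ "\<lambda>s. f' s + g' s"] allI has_vector_derivative_add arc_algebra.add)
next
  case (mult f g)
  then obtain f' g' where "f' \<in> arc_algebra \<phi>" "g' \<in> arc_algebra \<phi>"
    "\<And>s. (f has_vector_derivative f' s) (at s)" "\<And>s. (g has_vector_derivative g' s) (at s)" by blast
  thus ?case using mult.hyps
    by (intro bexI[of _ "\<lambda>s. f s * g' s + f' s * g s"] allI has_vector_derivative_mult
        arc_algebra.add arc_algebra.mult)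
qed

text \<open>The angular parametrization composed with the inverse arc length. Its period is one full
  turn, so one period is a simple loop and its winding number inside is 1 or -1; the direction of
  motion about \<open>m\<close> selects 1.\<close>

lemma arc_length_boundary_exists: "\<exists>\<gamma> L. arc_length_boundary region \<gamma> L"
proof -
  have "continuous_on UNIV speed"
    unfolding speed_eq[abs_def] by (intro continuous_intros)
  moreover have "speed (x + 2 * pi) = speed x" for x by (simp add: speed_eq)
  ultimately obtain \<phi> L where L: "L > 0"
    and phi: "\<And>s. (\<phi> has_real_derivative 1 / speed (\<phi> s)) (at s)" and surj: "surj \<phi>"
    and per: "\<And>s t k. \<phi> t = \<phi> s + of_int k * (2 * pi) \<longleftrightarrow> t = s + of_int k * L"
    using speed_pos periodic_speed_reparam[of speed] by metis
  define \<gamma> where "\<gamma> s = pt (cis (\<phi> s))" for s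
  have alg: "\<gamma> \<in> arc_algebra \<phi>"
  proof -
    have "\<gamma> = (\<lambda>s. m + (u * of_real p * of_real (cos (\<phi> s)) + u * (\<i> * of_real q) * of_real (sin (\<phi> s))))"
      by (auto simp: fun_eq_iff \<gamma>_def pt_def lin_def complex_eq_iff algebra_simps)
    moreover have "\<dots> \<in> arc_algebra \<phi>" by (intro arc_algebra.intros)
    ultimately show ?thesis by (simp only:)
  qed
  have sm: "smooth_curve \<gamma>"
    by (rule smooth_curve_if_closed[OF _ alg]) (rule arc_algebra_closed[OF phi])
  have vd: "(\<gamma> has_vector_derivative vel (cis (\<phi> s))) (at s)" for s
  proof -
    have "((\<lambda>s. cis (\<phi> s)) has_vector_derivative (1 / speed (\<phi> s)) *\<^sub>R (\<i> * cis (\<phi> s))) (at s)"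
    proof -
      have 1: "(cis has_vector_derivative \<i> * cis x) (at x)" for x
        unfolding has_vector_derivative_complex_iff
        by (auto intro!: derivative_eq_intros)
      have 2: "(\<phi> has_vector_derivative 1 / speed (\<phi> s)) (at s)"
        using phi by (simp add: has_real_derivative_iff_has_vector_derivative)
      from vector_diff_chain_at[OF 2 1] show ?thesis by (simp add: o_def)
    qed
    from bounded_linear.has_vector_derivative[OF _ this, of lin] linear_lin
    have "((\<lambda>s. lin (cis (\<phi> s))) has_vector_derivative lin ((1 / speed (\<phi> s)) *\<^sub>R (\<i> * cis (\<phi> s)))) (at s)"
      by (simp add: linear_conv_bounded_linear)
    hence "(\<gamma> has_vector_derivative lin ((1 / speed (\<phi> s)) *\<^sub>R (\<i> * cis (\<phi> s)))) (at s)"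
      unfolding \<gamma>_def[abs_def] pt_def by (simp add: has_vector_derivative_add_const add.commute[of m])
    moreover have "lin ((1 / speed (\<phi> s)) *\<^sub>R (\<i> * cis (\<phi> s))) = vel (cis (\<phi> s))"
      unfolding lin_simps lin_ii by (simp add: vel_def speed_def inverse_eq_divide)
    ultimately show ?thesis by simp
  qed
  have eq: "\<gamma> s = \<gamma> t \<longleftrightarrow> (\<exists>k::int. t = s + of_int k * L)" for s t
  proof -
    have "\<gamma> s = \<gamma> t \<longleftrightarrow> cis (\<phi> t) = cis (\<phi> s)" by (auto simp: \<gamma>_def)
    also have "\<dots> \<longleftrightarrow> (\<exists>k::int. \<phi> t = \<phi> s + of_int k * (2 * pi))"
      using sin_cos_eq_iff[of "\<phi> t" "\<phi> s"] by (auto simp: complex_eq_iff mult_ac)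
    finally show ?thesis by (simp add: per)
  qed
  have ran: "range \<gamma> = frontier region"
  proof -
    have "range \<gamma> = pt ` cis ` range \<phi>" by (auto simp: \<gamma>_def image_image)
    moreover have "cis ` UNIV = sphere 0 1"
    proof (intro set_eqI iffI)
      fix z :: complex assume "z \<in> sphere 0 1"
      hence "z = cis (Arg z)" using rcis_cmod_Arg[of z] by (simp add: rcis_def)
      thus "z \<in> cis ` UNIV" by blast
    qed auto
    ultimately show ?thesis by (simp add: surj frontier_region)
  qed
  have wn: "winding_number (\<lambda>t. \<gamma> (L * t)) z = 1" if z: "z \<in> region" for z
  proof -
    define c where "c t = \<gamma> (L * t)" for t
    have vp: "valid_path c" unfolding c_def by (rule valid_path_rescale(1)[OF sm])
    have im: "path_image c = frontier region"
    proof -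
      have "\<gamma> s \<in> path_image c" for s
      proof -
        \<comment> \<open>The fractional part of \<open>s / L\<close> moves \<open>s\<close> by
          whole periods into the parameter interval of \<open>c\<close>.\<close>
        define t where "t = s / L - of_int \<lfloor>s / L\<rfloor>"
        have t: "0 \<le> t" "t \<le> 1" unfolding t_def by linarith+
        have "L * t = s + of_int (- \<lfloor>s / L\<rfloor>) * L" using L by (simp add: t_def field_simps)
        hence "\<gamma> s = c t" unfolding c_def using eq by blast
        thus ?thesis using t by (auto simp: path_image_def)
      qed
      thus ?thesis unfolding ran[symmetric] by (auto simp: path_image_def c_def)
    qed
    have loop: "simple_path c"
    proof -
      have "x = y \<or> x = 0 \<and> y = 1 \<or> x = 1 \<and> y = 0"
        if xy: "x \<in> {0..1}" "y \<in> {0..1}" "c x = c y" for x y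
      proof -
        obtain k :: int where "L * y = L * x + of_int k * L" using xy(3) unfolding c_def eq by blast
        hence "L * (y - x - of_int k) = 0" by (simp add: algebra_simps)
        hence k: "y = x + of_int k" using L by simp
        hence "-1 \<le> k" "k \<le> 1" using xy by auto
        hence "k = -1 \<or> k = 0 \<or> k = 1" by auto
        thus ?thesis using k xy by auto
      qed
      thus ?thesis using vp valid_path_imp_path unfolding simple_path_def loop_free_def by blast
    qed
    have ins: "inside (path_image c) = region" unfolding im frontier_region by (rule inside_frontier_region)
    have m: "m = pt 0" by (simp add: pt_def linear_0[OF linear_lin])
    have "m \<in> region" using imageI[of 0 "ball 0 1" pt] m[symmetric] by simp
    have "m \<notin> path_image c" using ins \<open>m \<in> region\<close> inside_no_overlap by blast
    have "0 \<le> Re (winding_number c m)"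
    proof (rule winding_number_pos_le[OF vp \<open>m \<notin> path_image c\<close>])
      fix x :: real
      have "(c has_vector_derivative L *\<^sub>R vector_derivative \<gamma> (at (L * x))) (at x)"
        unfolding c_def by (rule valid_path_rescale(2)[OF sm])
      hence "vector_derivative c (at x) = L *\<^sub>R vel (cis (\<phi> (L * x)))"
        using vector_derivative_at[OF vd] by (simp add: vector_derivative_at)
      thus "0 \<le> Im (vector_derivative c (at x) * cnj (c x - m))"
        using pt_arc_velocity[of "cis (\<phi> (L * x))"] L
        by (auto intro!: mult_nonneg_nonneg simp: less_imp_le c_def \<gamma>_def)
    qed
    consider "\<And>z. z \<in> region \<Longrightarrow> winding_number c z = 1" | "\<And>z. z \<in> region \<Longrightarrow> winding_number c z = -1"
      using simple_closed_path_winding_number_inside[OF loop] unfolding ins by blast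
    hence "winding_number c z = 1"
    proof cases
      case 2
      thus ?thesis using \<open>m \<in> region\<close> \<open>0 \<le> Re (winding_number c m)\<close> by simp
    qed (use z in blast)
    thus ?thesis by (simp add: c_def[abs_def])
  qed
  have "arc_length_boundary region \<gamma> L"
    unfolding arc_length_boundary_def
    using sm ran L eq wn vector_derivative_at[OF vd] by (simp add: norm_vel)
  thus ?thesis by blast
qed

section \<open>The outer length billiard map around an ellipse\<close>

text \<open>The factor \<open>k\<close> may have either sign, so that both the negative and the
  positive tangent from \<open>pt x\<close> are covered.\<close>

lemma affine_hull_tang:
  assumes "z \<noteq> 0" "k \<noteq> 0" "pt x - pt z = k *\<^sub>R vel z"
  shows "affine hull {pt x, pt z} = tang z"
proof -
  have "affine hull {pt x, pt z} = range (\<lambda>t. pt z + t *\<^sub>R (pt x - pt z))"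
    by (subst insert_commute) (rule affine_hull_2_alt)
  also have "\<dots> = {pt z + t *\<^sub>R ((k / norm (nrm z)) *\<^sub>R (\<i> * nrm z)) |t. True}"
    unfolding assms(3) vel_def by (auto simp: divide_inverse)
  also have "\<dots> = tang z"
    unfolding tang_def by (rule line_eq_range) (use assms in \<open>auto simp: nrm_eq_0_iff\<close>)
  finally show ?thesis .
qed

lemma tangent_line_eq_tang:
  assumes "z \<noteq> 0" "\<gamma> s = pt z" "vector_derivative \<gamma> (at s) = vel z"
  shows "tangent_line \<gamma> s = tang z"
  unfolding tangent_line_def assms(2,3) by (rule tang_eq_range[OF assms(1)])

text \<open>The circle is found from \<open>l\<close>, the third tangent from the second solution of
  \<open>tritangent\<close>, and the image point is again on the confocal ellipse. The equivalence
  contains existence and uniqueness of the image, as is required to evaluate the description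
  operator in \<open>outer_length_map\<close>.\<close>

lemma outer_length_image_confocal:
  assumes arc: "arc_length_boundary region \<gamma>\<^sub>0 L\<^sub>0" and x: "norm x > 1" and l_pos: "l > 0"
    and conf: "p\<^sup>2 * (Re x)\<^sup>2 / (p\<^sup>2 + l) + q\<^sup>2 * (Im x)\<^sup>2 / (q\<^sup>2 + l) = 1"
  obtains y where "p\<^sup>2 * (Re y)\<^sup>2 / (p\<^sup>2 + l) + q\<^sup>2 * (Im y)\<^sup>2 / (q\<^sup>2 + l) = 1"
    "\<And>P. outer_length_image region (pt x) P \<longleftrightarrow> P = pt y"
proof -
  obtain z0 z1 where
    z0: "\<And>z. norm z = 1 \<and> (\<exists>t>0. pt x - pt z = t *\<^sub>R vel z) \<longleftrightarrow> z = z0" and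
    z1: "\<And>z. norm z = 1 \<and> (\<exists>t>0. pt z - pt x = t *\<^sub>R vel z) \<longleftrightarrow> z = z1" and
    D: "-1 < z1 \<bullet> z0" "z1 \<bullet> z0 < 1" and xz: "x = (z1 + z0) /\<^sub>R (1 + z1 \<bullet> z0)"
    using tangency_points[OF x] by metis
  have n0: "norm z0 = 1" "\<exists>t>0. pt x - pt z0 = t *\<^sub>R vel z0" using z0[of z0] by auto
  have n1: "norm z1 = 1" "\<exists>t>0. pt z1 - pt x = t *\<^sub>R vel z1" using z1[of z1] by auto
  have nz: "z0 \<noteq> 0" "z1 \<noteq> 0" using n0 n1 by auto
  have hull0: "affine hull {pt x, pt z0} = tang z0"
    using n0 affine_hull_tang[OF nz(1)] by (metis less_irrefl)
  have hull1: "affine hull {pt x, pt z1} = tang z1"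
  proof -
    from n1 obtain t where t: "t > 0" "pt z1 - pt x = t *\<^sub>R vel z1" by blast
    have "pt x - pt z1 = (- t) *\<^sub>R vel z1" by (simp flip: t(2))
    thus ?thesis using affine_hull_tang[OF nz(2), of "- t"] t by simp
  qed
  define \<mu> where "\<mu> = l / (p * q)"
  have mu: "\<mu> > 0" using l_pos p_pos q_pos by (simp add: \<mu>_def)
  \<comment> \<open>\<open>pt x\<close> is the intersection of the tangents at \<open>z1\<close> and
    \<open>z0\<close>, so its position on the confocal ellipse says that the circle with this \<mu>
    touches the negative tangent.\<close>
  have T0: "tritangent \<mu> z1 z0 = 0"
    unfolding \<mu>_def by (rule confocal_iff_tritangent[THEN iffD1, OF n1(1) n0(1) _ l_pos xz conf]) (use D in auto)
  have ne01: "z1 \<noteq> z0" using tritangent_nz(1)[OF n1(1) n0(1) mu T0] by auto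
  obtain z2 where z2: "\<And>v. norm v = 1 \<and> v \<noteq> z0 \<and> tritangent \<mu> z1 v = 0 \<longleftrightarrow> v = z2"
    using tritangent_second[OF n1(1) n0(1) mu T0] by metis
  have n2: "norm z2 = 1" "z2 \<noteq> z0" and T2: "tritangent \<mu> z1 z2 = 0" using z2[of z2] by auto
  note nz12 = tritangent_nz[OF n1(1) n2(1) mu T2]
  have nz2: "z2 \<noteq> 0" using n2 by auto
  have ne12: "z1 \<noteq> z2" using nz12(1) by auto
  define y where "y = (z1 + z2) /\<^sub>R (1 + z1 \<bullet> z2)"
  have inter: "tang z2 \<inter> tang z1 = {pt y}"
    using tang_inter[OF n1(1) n2(1) nz12(2,3)] unfolding y_def by (simp add: Int_commute)
  have confy: "p\<^sup>2 * (Re y)\<^sup>2 / (p\<^sup>2 + l) + q\<^sup>2 * (Im y)\<^sup>2 / (q\<^sup>2 + l) = 1"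
    by (rule confocal_iff_tritangent[THEN iffD2, OF n1(1) n2(1) _ l_pos y_def]) (use T2 nz12 in \<open>auto simp: \<mu>_def\<close>)
  define N where "N = norm (nrm z1)"
  have N: "N > 0" using nz by (simp add: N_def nrm_eq_0_iff)
  have ex: "outer_length_image region (pt x) (pt y)"
  proof -
    obtain s0 where s0: "\<gamma>\<^sub>0 s0 = pt z0" "vector_derivative \<gamma>\<^sub>0 (at s0) = vel z0"
      by (rule arc_length_boundary_surj[OF arc n0(1)])
    obtain s1 where s1: "\<gamma>\<^sub>0 s1 = pt z1" "vector_derivative \<gamma>\<^sub>0 (at s1) = vel z1"
      by (rule arc_length_boundary_surj[OF arc n1(1)])
    obtain s2 where s2: "\<gamma>\<^sub>0 s2 = pt z2" "vector_derivative \<gamma>\<^sub>0 (at s2) = vel z2"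
      by (rule arc_length_boundary_surj[OF arc n2(1)])
    note tl = tangent_line_eq_tang[OF nz(2) s1] tangent_line_eq_tang[OF nz2 s2]
    define c where "c = pt z1 + \<mu> *\<^sub>R nrm z1"
    have r: "\<mu> * N > 0" using mu N by simp
    show ?thesis
      unfolding outer_length_image_def
    proof (rule exI[of _ "\<gamma>\<^sub>0"], rule exI[of _ "L\<^sub>0"], rule exI[of _ s0], rule exI[of _ s1], rule exI[of _ s2],
        rule exI[of _ c], rule exI[of _ "\<mu> * N"], intro conjI)
      show "arc_length_boundary region \<gamma>\<^sub>0 L\<^sub>0" by (rule arc)
      show "\<exists>t>0. pt x - \<gamma>\<^sub>0 s0 = t *\<^sub>R vector_derivative \<gamma>\<^sub>0 (at s0)" unfolding s0 by (rule n0(2))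
      show "\<exists>t>0. \<gamma>\<^sub>0 s1 - pt x = t *\<^sub>R vector_derivative \<gamma>\<^sub>0 (at s1)" unfolding s1 by (rule n1(2))
      show "\<mu> * N > 0" by (rule r)
      show "cball c (\<mu> * N) \<inter> region = {}"
        using cball_disjoint_iff[OF n1(1), of \<mu>] mu by (simp add: c_def N_def)
      show "tangent_line \<gamma>\<^sub>0 s1 \<inter> sphere c (\<mu> * N) = {\<gamma>\<^sub>0 s1}"
        unfolding tl s1 tang_def
        by (rule circle_tangent_at_iff[THEN iffD2]) (use nz r mu in \<open>auto simp: nrm_eq_0_iff c_def N_def\<close>)
      show "line_tangent_circle (affine hull {pt x, \<gamma>\<^sub>0 s0}) c (\<mu> * N)"
        unfolding s0 hull0 c_def N_def using tritangent_iff[OF n1(1) n0(1) ne01 mu] T0 by blast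
      show "line_tangent_circle (tangent_line \<gamma>\<^sub>0 s2) c (\<mu> * N)"
        unfolding tl c_def N_def using tritangent_iff[OF n1(1) n2(1) ne12 mu] T2 by blast
      show "tangent_line \<gamma>\<^sub>0 s2 \<noteq> affine hull {pt x, \<gamma>\<^sub>0 s0}"
        unfolding s0 hull0 tl using tang_eq_iff n0 n2 by blast
      show "tangent_line \<gamma>\<^sub>0 s2 \<noteq> affine hull {pt x, \<gamma>\<^sub>0 s1}"
        unfolding s1 hull1 tl using tang_eq_iff n1(1) n2 ne12 by blast
      show "tangent_line \<gamma>\<^sub>0 s2 \<inter> affine hull {pt x, \<gamma>\<^sub>0 s1} = {pt y}"
        unfolding s1 hull1 tl by (rule inter)
    qed
  qed
  \<comment> \<open>Any data witnessing the relation are reduced to those above: first the tangency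
    points, then the circle, then the third tangent.\<close>
  have uniq: "P = pt y" if img: "outer_length_image region (pt x) P" for P
  proof -
    obtain \<gamma> L s0 s1 s2 c r where
      arc': "arc_length_boundary region \<gamma> L" and
      t0: "\<exists>t>0. pt x - \<gamma> s0 = t *\<^sub>R vector_derivative \<gamma> (at s0)" and
      t1: "\<exists>t>0. \<gamma> s1 - pt x = t *\<^sub>R vector_derivative \<gamma> (at s1)" and
      r: "r > 0" and disj: "cball c r \<inter> region = {}" and
      circ: "tangent_line \<gamma> s1 \<inter> sphere c r = {\<gamma> s1}" and
      lt0: "line_tangent_circle (affine hull {pt x, \<gamma> s0}) c r" and
      lt2: "line_tangent_circle (tangent_line \<gamma> s2) c r" and
      ne0: "tangent_line \<gamma> s2 \<noteq> affine hull {pt x, \<gamma> s0}" and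
      ne1: "tangent_line \<gamma> s2 \<noteq> affine hull {pt x, \<gamma> s1}" and
      P: "tangent_line \<gamma> s2 \<inter> affine hull {pt x, \<gamma> s1} = {P}"
      using img unfolding outer_length_image_def by (elim exE) (rule that; elim conjE; assumption)
    obtain y0 where y0: "norm y0 = 1" "\<gamma> s0 = pt y0" "vector_derivative \<gamma> (at s0) = vel y0"
      by (rule arc_length_boundary_velocity[OF arc'])
    obtain y1 where y1: "norm y1 = 1" "\<gamma> s1 = pt y1" "vector_derivative \<gamma> (at s1) = vel y1"
      by (rule arc_length_boundary_velocity[OF arc'])
    obtain y2 where y2: "norm y2 = 1" "\<gamma> s2 = pt y2" "vector_derivative \<gamma> (at s2) = vel y2"
      by (rule arc_length_boundary_velocity[OF arc'])
    have "y0 = z0" using t0 y0(1) z0[of y0] unfolding y0(2,3) by blast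
    note y0 = y0[unfolded this]
    have "y1 = z1" using t1 y1(1) z1[of y1] unfolding y1(2,3) by blast
    note y1 = y1[unfolded this]
    have nzy: "y2 \<noteq> 0" using y2(1) by auto
    note tl = tangent_line_eq_tang[OF nz(2) y1(2,3)] tangent_line_eq_tang[OF nzy y2(2,3)]
    \<comment> \<open>Tangency at \<open>pt z1\<close> puts the centre on the normal, exteriority
      makes \<nu> positive, and tangency to the negative tangent then forces
      \<open>\<nu> = \<mu>\<close>.\<close>
    obtain \<nu> where c: "c = pt z1 + \<nu> *\<^sub>R nrm z1" and rnu: "\<bar>\<nu>\<bar> * norm (nrm z1) = r"
      using circ circle_tangent_at_iff[of "nrm z1" r "pt z1" c] nz r
      unfolding tl y1(2) tang_def by (auto simp: nrm_eq_0_iff)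
    have "\<nu> \<noteq> 0" using rnu r by auto
    hence nu: "\<nu> > 0" using cball_disjoint_iff[OF n1(1)] disj unfolding c rnu[symmetric] by blast
    hence rnu: "r = \<nu> * norm (nrm z1)" using rnu by simp
    have "tritangent \<nu> z1 z0 = 0"
      using lt0 tritangent_iff[OF n1(1) n0(1) ne01 nu] unfolding y0(2) hull0 c rnu by blast
    hence nu_mu: "\<nu> = \<mu>" using tritangent_radius_unique[OF n1(1) n0(1) nu mu] T0 by blast
    have "y2 \<noteq> z0" using ne0 unfolding y0(2) hull0 tl by blast
    moreover have "z1 \<noteq> y2" using ne1 unfolding y1(2) hull1 tl by blast
    hence "tritangent \<mu> z1 y2 = 0"
      using lt2 tritangent_iff[OF n1(1) y2(1) _ nu] unfolding tl c rnu nu_mu by blast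
    ultimately have "y2 = z2" using z2[of y2] y2(1) by blast
    hence "{P} = {pt y}" using P inter unfolding y1(2) hull1 tl by simp
    thus ?thesis by simp
  qed
  show thesis by (rule that[of y]) (use confy ex uniq in blast)+
qed

end

section \<open>Confocal ellipses\<close>

text \<open>From \<open>A + B = 2 * a\<close> and \<open>A\<^sup>2 - B\<^sup>2 = 4 * f * x\<close>
  follows the focal radius \<open>A = a + k\<close> with \<open>k = f * x / a\<close>. Both
  conditions amount to the square of this relation.\<close>

lemma sum_dist_foci_iff:
  fixes w :: complex
  assumes f: "0 \<le> f" "f < a"
  shows "norm (w + of_real f) + norm (w - of_real f) = 2 * a \<longleftrightarrow>
         (Re w)\<^sup>2 / a\<^sup>2 + (Im w)\<^sup>2 / (a\<^sup>2 - f\<^sup>2) = 1"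
proof -
  define x y where "x = Re w" and "y = Im w"
  define A B where "A = norm (w + of_real f)" and "B = norm (w - of_real f)"
  have A: "A\<^sup>2 = (x + f)\<^sup>2 + y\<^sup>2" "A \<ge> 0" and B: "B\<^sup>2 = (x - f)\<^sup>2 + y\<^sup>2" "B \<ge> 0"
    by (auto simp: A_def B_def x_def y_def cmod_power2)
  have a: "a > 0" "a\<^sup>2 > 0" "a\<^sup>2 - f\<^sup>2 > 0" using f by (auto simp: power_strict_mono)
  define k where "k = f * x / a"
  have k: "k * a = f * x" using a by (simp add: k_def)
  have "x\<^sup>2 / a\<^sup>2 + y\<^sup>2 / (a\<^sup>2 - f\<^sup>2) = 1 \<longleftrightarrow> x\<^sup>2 * (a\<^sup>2 - f\<^sup>2) + y\<^sup>2 * a\<^sup>2 - a\<^sup>2 * (a\<^sup>2 - f\<^sup>2) = 0"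
  proof -
    have "s / P + t / Q = 1 \<longleftrightarrow> s * Q + t * P - P * Q = 0" if "P > 0" "Q > 0" for s t P Q :: real
      using that by (auto simp: field_simps)
    thus ?thesis using a by blast
  qed
  also have "\<dots> \<longleftrightarrow> (a + k)\<^sup>2 = (x + f)\<^sup>2 + y\<^sup>2"
  proof -
    have "x\<^sup>2 * (a\<^sup>2 - f\<^sup>2) + y\<^sup>2 * a\<^sup>2 - a\<^sup>2 * (a\<^sup>2 - f\<^sup>2) = - (a\<^sup>2 * ((a + k)\<^sup>2 - ((x + f)\<^sup>2 + y\<^sup>2)))"
      using k by algebra
    thus ?thesis using a by simp
  qed
  also have "\<dots> \<longleftrightarrow> A + B = 2 * a"
  proof
    assume AB: "A + B = 2 * a"
    have "a * (2 * (A - a)) = a * (2 * k)" using AB A(1) B(1) k by algebra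
    hence "A = a + k" using a by simp
    thus "(a + k)\<^sup>2 = (x + f)\<^sup>2 + y\<^sup>2" using A by simp
  next
    assume *: "(a + k)\<^sup>2 = (x + f)\<^sup>2 + y\<^sup>2"
    have B': "(a - k)\<^sup>2 = (x - f)\<^sup>2 + y\<^sup>2" using * k by algebra
    \<comment> \<open>For the converse, square roots must be taken with the right sign: the equation
      bounds \<open>x\<close> by \<open>a\<close>, hence \<open>k\<close> by \<open>a\<close>, so
      \<open>a + k\<close> and \<open>a - k\<close> are nonnegative.\<close>
    have "(a\<^sup>2 - f\<^sup>2) * x\<^sup>2 + a\<^sup>2 * y\<^sup>2 = (a\<^sup>2 - f\<^sup>2) * a\<^sup>2" using * k by algebra
    hence "(a\<^sup>2 - f\<^sup>2) * x\<^sup>2 \<le> (a\<^sup>2 - f\<^sup>2) * a\<^sup>2" using a(2) zero_le_power2[of y]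
      by (smt (verit) mult_nonneg_nonneg)
    hence "x\<^sup>2 \<le> a\<^sup>2" by (rule mult_left_le_imp_le) (rule a(3))
    hence "\<bar>x\<bar> \<le> a" using abs_le_square_iff[of x a] a(1) by simp
    hence "f * \<bar>x\<bar> \<le> a * a" using f by (intro mult_mono) auto
    hence "\<bar>k\<bar> \<le> a"
      using f(1) a(1) by (simp add: k_def abs_mult pos_divide_le_eq)
    hence "0 \<le> a + k" "0 \<le> a - k" by auto
    hence "A = a + k" "B = a - k"
      using power2_eq_iff_nonneg[OF A(2), of "a + k"] power2_eq_iff_nonneg[OF B(2), of "a - k"]
      by (simp_all add: A(1) B(1) * B')
    thus "A + B = 2 * a" by simp
  qed
  finally show ?thesis by (simp add: A_def B_def x_def y_def)
qed

context ellipse_frame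
begin

lemma pt_in_ellipse_iff:
  assumes "0 \<le> f" "f < b"
  shows "pt z \<in> ellipse (m - u * of_real f) (m + u * of_real f) b \<longleftrightarrow>
         p\<^sup>2 * (Re z)\<^sup>2 / b\<^sup>2 + q\<^sup>2 * (Im z)\<^sup>2 / (b\<^sup>2 - f\<^sup>2) = 1"
proof -
  define w where "w = Complex (p * Re z) (q * Im z)"
  have "dist (pt z) (m - u * of_real f) = norm (u * (w + of_real f))"
    "dist (pt z) (m + u * of_real f) = norm (u * (w - of_real f))"
    by (simp_all add: dist_norm pt_def lin_def w_def algebra_simps)
  hence "pt z \<in> ellipse (m - u * of_real f) (m + u * of_real f) b \<longleftrightarrow>
      norm (w + of_real f) + norm (w - of_real f) = 2 * b"
    by (simp add: ellipse_def norm_mult)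
  also have "\<dots> \<longleftrightarrow> (Re w)\<^sup>2 / b\<^sup>2 + (Im w)\<^sup>2 / (b\<^sup>2 - f\<^sup>2) = 1"
    by (rule sum_dist_foci_iff[OF assms])
  finally show ?thesis by (simp add: w_def power_mult_distrib)
qed

lemma ellipse_eq_pt_sphere:
  assumes "0 \<le> f" "q\<^sup>2 = p\<^sup>2 - f\<^sup>2"
  shows "ellipse (m - u * of_real f) (m + u * of_real f) p = pt ` sphere 0 1"
proof -
  have "q\<^sup>2 > 0" using q_pos by simp
  hence "f\<^sup>2 < p\<^sup>2" using assms by simp
  hence f: "f < p" using p_pos by (simp add: power2_less_imp_less less_imp_le)
  have "pt z \<in> ellipse (m - u * of_real f) (m + u * of_real f) p \<longleftrightarrow> z \<in> sphere 0 1" for z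
  proof -
    have "z \<in> sphere 0 1 \<longleftrightarrow> (norm z)\<^sup>2 = 1" by (simp add: power2_eq_1_iff) (use norm_ge_zero[of z] in linarith)
    thus ?thesis
      unfolding pt_in_ellipse_iff[OF assms(1) f] using p_pos q_pos by (simp add: cmod_power2 flip: assms(2))
  qed
  hence "pt -` ellipse (m - u * of_real f) (m + u * of_real f) p = sphere 0 1" by blast
  thus ?thesis using surj_image_vimage_eq[OF surj_pt] by metis
qed

lemma billiard_domain_region: "billiard_domain region"
  unfolding billiard_domain_def
  using open_region convex_connected[OF convex_region] bounded_region strictly_convex_region arc_length_boundary_exists
  by simp

lemma pt_sphere_simple_loop:
  "\<exists>g. simple_path g \<and> pathfinish g = pathstart g \<and> path_image g = pt ` sphere 0 1"
proof (intro exI conjI)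
  have "simple_path (lin \<circ> circlepath 0 1)"
    by (simp add: simple_path_linear_image_eq linear_lin inj_lin simple_path_circlepath)
  hence "simple_path ((+) m \<circ> (lin \<circ> circlepath 0 1))"
    by (subst simple_path_translation_eq)
  thus "simple_path (pt \<circ> circlepath 0 1)" by (simp add: o_def pt_def)
  show "pathfinish (pt \<circ> circlepath 0 1) = pathstart (pt \<circ> circlepath 0 1)"
    by (simp add: pathfinish_compose pathstart_compose)
  show "path_image (pt \<circ> circlepath 0 1) = pt ` sphere 0 1"
    by (simp add: path_image_compose)
qed

text \<open>Writing \<open>p\<^sup>2 / (p\<^sup>2 + l)\<close> as
  \<open>1 - l / (p\<^sup>2 + l)\<close>, and likewise for \<open>q\<close>, exhibits the squared
  norm of \<open>z\<close> as 1 plus a positive quantity.\<close>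

lemma confocal_norm_gt_1:
  assumes l: "l > 0" and conf: "p\<^sup>2 * (Re z)\<^sup>2 / (p\<^sup>2 + l) + q\<^sup>2 * (Im z)\<^sup>2 / (q\<^sup>2 + l) = 1"
  shows "norm z > 1"
proof -
  define x y where "x = (Re z)\<^sup>2" and "y = (Im z)\<^sup>2"
  have xy: "x \<ge> 0" "y \<ge> 0" by (auto simp: x_def y_def)
  have P: "p\<^sup>2 + l > 0" "q\<^sup>2 + l > 0" using l by (auto intro: add_nonneg_pos)
  have "p\<^sup>2 * x / (p\<^sup>2 + l) = x - l * (x / (p\<^sup>2 + l))" "q\<^sup>2 * y / (q\<^sup>2 + l) = y - l * (y / (q\<^sup>2 + l))"
    using P by (auto simp: field_simps)
  hence eq: "x + y = 1 + l * (x / (p\<^sup>2 + l) + y / (q\<^sup>2 + l))"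
    using conf by (simp add: x_def y_def algebra_simps)
  have "x / (p\<^sup>2 + l) \<ge> 0" "y / (q\<^sup>2 + l) \<ge> 0" using xy P by auto
  moreover have "x > 0 \<or> y > 0" using conf xy by (auto simp: x_def y_def)
  hence "x / (p\<^sup>2 + l) > 0 \<or> y / (q\<^sup>2 + l) > 0" using P divide_pos_pos by blast
  ultimately have "x / (p\<^sup>2 + l) + y / (q\<^sup>2 + l) > 0" by linarith
  hence "x + y > 1" using eq l by simp
  hence "(norm z)\<^sup>2 > 1\<^sup>2" by (simp add: cmod_power2 x_def y_def)
  thus ?thesis using power2_less_imp_less norm_ge_zero by blast
qed

lemma outer_length_map_confocal:
  assumes l: "l > 0" and conf: "p\<^sup>2 * (Re x)\<^sup>2 / (p\<^sup>2 + l) + q\<^sup>2 * (Im x)\<^sup>2 / (q\<^sup>2 + l) = 1"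
  obtains y where "p\<^sup>2 * (Re y)\<^sup>2 / (p\<^sup>2 + l) + q\<^sup>2 * (Im y)\<^sup>2 / (q\<^sup>2 + l) = 1"
    "outer_length_map region (pt x) = pt y"
proof -
  obtain \<gamma> L where "arc_length_boundary region \<gamma> L" using arc_length_boundary_exists by blast
  then obtain y where y: "p\<^sup>2 * (Re y)\<^sup>2 / (p\<^sup>2 + l) + q\<^sup>2 * (Im y)\<^sup>2 / (q\<^sup>2 + l) = 1"
    "\<And>P. outer_length_image region (pt x) P \<longleftrightarrow> P = pt y"
    using outer_length_image_confocal[OF _ confocal_norm_gt_1[OF l conf] l conf] by metis
  moreover have "outer_length_map region (pt x) = pt y"
    unfolding outer_length_map_def y(2) by simp
  ultimately show thesis using that by blast
qed

end

theorem proposition4: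
  fixes F1 F2 :: complex and a b :: real
  assumes "dist F1 F2 < 2 * a" and "dist F1 F2 < 2 * b"
    and "ellipse F1 F2 a \<subseteq> inside (ellipse F1 F2 b)"
  shows "outer_length_caustic (inside (ellipse F1 F2 a)) (ellipse F1 F2 b)"
proof -
  define f where "f = dist F1 F2 / 2"
  define m where "m = (F1 + F2) / 2"
  \<comment> \<open>For coinciding foci \<open>sgn\<close> would give 0, so the unit vector 1 is
    taken; then \<open>f = 0\<close> and the direction is immaterial.\<close>
  define u where "u = (if F1 = F2 then 1 else sgn (F2 - F1))"
  have f: "0 \<le> f" "f < a" "f < b" using assms by (auto simp: f_def)
  have u: "norm u = 1" by (simp add: u_def norm_sgn)
  have "u * of_real (2 * f) = F2 - F1"
    by (simp add: u_def f_def dist_norm norm_minus_commute sgn_div_norm scaleR_conv_of_real)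
  hence F: "F1 = m - u * of_real f" "F2 = m + u * of_real f"
    by (simp_all add: m_def field_simps)
  define q q' where "q = sqrt (a\<^sup>2 - f\<^sup>2)" and "q' = sqrt (b\<^sup>2 - f\<^sup>2)"
  have "f\<^sup>2 < a\<^sup>2" "f\<^sup>2 < b\<^sup>2" using f by (auto intro: power_strict_mono)
  hence q: "q > 0" "q\<^sup>2 = a\<^sup>2 - f\<^sup>2" and q': "q' > 0" "q'\<^sup>2 = b\<^sup>2 - f\<^sup>2"
    by (auto simp: q_def q'_def)
  interpret E: ellipse_frame m u a q using u f q by unfold_locales auto
  interpret G: ellipse_frame m u b q' using u f q' by unfold_locales auto
  have ell_a: "ellipse F1 F2 a = E.pt ` sphere 0 1" and ell_b: "ellipse F1 F2 b = G.pt ` sphere 0 1"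
    unfolding F using E.ellipse_eq_pt_sphere[OF f(1) q(2)] G.ellipse_eq_pt_sphere[OF f(1) q'(2)] by auto
  have ins_a: "inside (ellipse F1 F2 a) = E.region" and ins_b: "inside (ellipse F1 F2 b) = G.region"
    unfolding ell_a ell_b by (rule E.inside_frontier_region G.inside_frontier_region)+
  have E_eq_G: "E.pt z = G.pt (Complex (a * Re z / b) (q * Im z / q'))" for z
    using f q' by (simp add: E.pt_def G.pt_def E.lin_def G.lin_def)
  have "a < b"
  proof -
    \<comment> \<open>\<open>E.pt 1\<close> is an end of the major axis of the inner ellipse; its
      lying inside the outer one compares the semi-axes.\<close>
    have "E.pt 1 \<in> G.region" using assms(3) unfolding ins_b ell_a by auto
    hence "Complex (a / b) 0 \<in> ball 0 1" unfolding E_eq_G by auto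
    hence "\<bar>a / b\<bar> < 1" by (simp add: cmod_def)
    thus ?thesis using f by simp
  qed
  hence ab: "a\<^sup>2 < b\<^sup>2" using f by (auto intro: power_strict_mono)
  \<comment> \<open>Since both ellipses have the same \<open>f\<close>, this is also
    \<open>q'\<^sup>2 - q\<^sup>2\<close>, so one parameter serves both axes.\<close>
  define l where "l = b\<^sup>2 - a\<^sup>2"
  have l: "l > 0" using ab by (simp add: l_def)
  have conf: "E.pt z \<in> ellipse F1 F2 b \<longleftrightarrow> a\<^sup>2 * (Re z)\<^sup>2 / (a\<^sup>2 + l) + q\<^sup>2 * (Im z)\<^sup>2 / (q\<^sup>2 + l) = 1" for z
    unfolding F E.pt_in_ellipse_iff[OF f(1,3)] by (simp add: l_def q)
  show ?thesis
    unfolding outer_length_caustic_def ins_a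
  proof (intro conjI ballI)
    show "billiard_domain E.region" by (rule E.billiard_domain_region)
    show "\<exists>g. simple_path g \<and> pathfinish g = pathstart g \<and> path_image g = ellipse F1 F2 b"
      unfolding ell_b by (rule G.pt_sphere_simple_loop)
    show "ellipse F1 F2 b \<inter> closure E.region = {}"
      unfolding E.closure_region using conf E.confocal_norm_gt_1[OF l] by fastforce
    show "E.region \<subseteq> inside (ellipse F1 F2 b)"
    proof -
      \<comment> \<open>In the coordinates of the outer frame, passing from the inner ellipse scales
        the two axes by \<open>a / b\<close> and \<open>q / q'\<close>, neither of which exceeds
        1.\<close>
      have "Complex (a * Re z / b) (q * Im z / q') \<in> ball 0 1" if "norm z < 1" for z
      proof -
        have "a / b \<le> 1" "q / q' \<le> 1"
          using f q' \<open>a < b\<close> ab by (auto simp: q_def q'_def)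
        hence "(a / b)\<^sup>2 \<le> 1" "(q / q')\<^sup>2 \<le> 1" using f q q' by (auto intro!: power_le_one)
        hence "(a / b)\<^sup>2 * (Re z)\<^sup>2 \<le> (Re z)\<^sup>2" "(q / q')\<^sup>2 * (Im z)\<^sup>2 \<le> (Im z)\<^sup>2"
          by (auto intro!: mult_left_le_one_le)
        hence "(norm (Complex (a * Re z / b) (q * Im z / q')))\<^sup>2 \<le> (norm z)\<^sup>2"
          unfolding cmod_power2 by (simp add: power_mult_distrib power_divide)
        hence "norm (Complex (a * Re z / b) (q * Im z / q')) \<le> norm z"
          using power2_le_imp_le norm_ge_zero by blast
        thus ?thesis using that by simp
      qed
      thus ?thesis unfolding ins_b using E_eq_G by auto
    qed
  next
    fix P assume P: "P \<in> ellipse F1 F2 b"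
    obtain x where x: "P = E.pt x" using E.surj_pt by (metis surjD)
    obtain y where "a\<^sup>2 * (Re y)\<^sup>2 / (a\<^sup>2 + l) + q\<^sup>2 * (Im y)\<^sup>2 / (q\<^sup>2 + l) = 1" "outer_length_map E.region P = E.pt y"
      using E.outer_length_map_confocal[OF l] P conf unfolding x by metis
    thus "outer_length_map E.region P \<in> ellipse F1 F2 b" by (simp add: conf)
  qed
qed

end
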